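(* The solution $u_3(x,t)$ of the Cauchy problem $$\frac{\partial u}{\partial t}=-\frac{\partial^3u}{\partial x^3},\quad x\in\mathbb{R},\ t>0,\qquad u(x,0)=\delta(x),$$ can be written, for $x\in\mathbb{R}$ and $t>0$, as $$u_3(x,t)=\frac{1}{\pi x}\,E\left[e^{-\frac{x}{2}G^{3}(1/t)}\sin\left(\frac{\sqrt{3}\,x}{2}G^{3}(1/t)\right)\right]=\frac{3t}{\pi x}\int_0^\infty e^{-\frac{xy}{2}}\sin\left(\frac{\sqrt3}{2}xy\right)y^2e^{-ty^3}\,dy=\frac{1}{\sqrt[3]{3t}}\,\mathrm{Ai}\left(\frac{x}{\sqrt[3]{3t}}\right).$$
   Context: $\delta$ is the Dirac delta at $0$, $E$ is expectation, and $\mathrm{Ai}$ is the Airy function of the first kind. For $\gamma>0$, $t>0$, $G^{\gamma}(t)$ is a positive random variable with generalized gamma density $g^{\gamma}(x,t)=\gamma\frac{x^{\gamma-1}}{t}\exp(-x^{\gamma}/t)$, $x>0$; the superscript $3$ in $G^3(1/t)$ is the parameter $\gamma=3$, not a power. "The solution" means the fundamental solution, i.e. the function with Fourier transform $\int_{\mathbb{R}}e^{i\beta x}u_3(x,t)\,dx=e^{-it\beta^{3}}$; equivalently $u_3(x,t)=\frac{1}{2\pi}\int_{\mathbb{R}}e^{-i\beta x-it\beta^{3}}\,d\beta$ (a conditionally convergent oscillatory integral). At $x=0$ the expressions with the factor $1/x$ are understood as their limits as $x\to0$. *)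

theory Defs
  imports "HOL-Probability.Probability"
begin

definition gen_gamma_density :: "real \<Rightarrow> real \<Rightarrow> real \<Rightarrow> real" where
  "gen_gamma_density \<gamma> t x =
     (if x > 0 then \<gamma> * (x powr (\<gamma> - 1) / t) * exp (- (x powr \<gamma>) / t) else 0)"

text \<open>
  The integrals in the next two definitions converge only conditionally. The Henstock--Kurzweil
  integral over an unbounded interval is the limit of the integrals over bounded intervals,
  so it is the improper integral; the Lebesgue integral would not exist.
\<close>

definition airy_Ai :: "real \<Rightarrow> real" where
  "airy_Ai z = 1 / pi * integral {0..} (\<lambda>s. cos (s ^ 3 / 3 + z * s))"

definition u3 :: "real \<Rightarrow> real \<Rightarrow> complex" where
  "u3 x t = 1 / (2 * of_real pi) *
     integral UNIV (\<lambda>\<beta>::real. exp (- (\<i> * of_real \<beta> * of_real x) - \<i> * of_real t * of_real \<beta> ^ 3))"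

definition test_function :: "(real \<Rightarrow> real) \<Rightarrow> bool" where
  "test_function \<phi> \<longleftrightarrow>
     (\<forall>k x. (deriv ^^ k) \<phi> differentiable at x) \<and> compact (closure {x. \<phi> x \<noteq> 0})"

text \<open>
  The equation holds classically at every point with positive time. The initial datum, the
  Dirac delta, is attained in the sense of distributions as time decreases to zero.
\<close>

definition solves_cauchy_problem :: "(real \<Rightarrow> real \<Rightarrow> complex) \<Rightarrow> bool" where
  "solves_cauchy_problem u \<longleftrightarrow>
     (\<exists>ux uxx uxxx. \<forall>x. \<forall>t>0.
        ((\<lambda>y. u y t) has_vector_derivative ux x t) (at x) \<and>
        ((\<lambda>y. ux y t) has_vector_derivative uxx x t) (at x) \<and>
        ((\<lambda>y. uxx y t) has_vector_derivative uxxx x t) (at x) \<and>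
        ((\<lambda>s. u x s) has_vector_derivative - uxxx x t) (at t)) \<and>
     (\<forall>\<phi>. test_function \<phi> \<longrightarrow>
        ((\<lambda>t. LINT x|lborel. \<phi> x *\<^sub>R u x t) \<longlongrightarrow> of_real (\<phi> 0)) (at_right 0))"

end

theory Submission
  imports Defs "HOL-Complex_Analysis.Complex_Analysis" "HOL-Real_Asymp.Real_Asymp"
begin

text \<open>
  Cauchy's theorem turns the oscillatory integral of \<open>exp (\<i>(x\<beta> + t\<beta>\<^sup>3))\<close> over \<open>\<beta> \<ge> 0\<close> into
  an integral along the ray of argument \<open>\<pi>/6\<close>, where \<open>\<i>\<beta>\<^sup>3\<close> becomes \<open>-y\<^sup>3\<close> and everything
  converges absolutely. Differentiating under the rotated integral gives the differential equation,
  rescaling gives the Airy function, and one integration by parts gives the factor \<open>1/x\<close> together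
  with the generalized gamma density.

  The rotated integrand is not dominated uniformly as \<open>t\<close> decreases to zero, so the initial
  condition is taken on the Fourier side: the pairing with a test function is the integral of
  \<open>b(\<beta>) exp (\<i>t\<beta>\<^sup>3)\<close> with \<open>b\<close> of order \<open>1/(1 + \<beta>\<^sup>2)\<close>, and at \<open>t = 0\<close> the limit is evaluated with
  the sine integral.
\<close>

section \<open>Improper integrals and differentiation under the integral sign\<close>

lemma has_integral_atLeast_tendsto:
  fixes f :: "real \<Rightarrow> 'a::banach"
  assumes int: "\<And>d. f integrable_on {a..d}"
    and lim: "((\<lambda>d. integral {a..d} f) \<longlongrightarrow> L) at_top"
  shows "(f has_integral L) {a..}"
  unfolding has_integral_alt'
proof (intro conjI allI impI)
  fix c d :: real
  have "f integrable_on {max a c..d}"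
    by (rule integrable_on_subinterval[OF int[of d]]) auto
  moreover have "{a..} \<inter> cbox c d = {max a c..d}" by auto
  ultimately show "(\<lambda>x. if x \<in> {a..} then f x else 0) integrable_on cbox c d"
    by (simp only: integrable_restrict_Int)
next
  fix e :: real assume "e > 0"
  then obtain N where N: "\<And>y. y \<ge> N \<Longrightarrow> dist (integral {a..y} f) L < e"
    using lim unfolding tendsto_iff eventually_at_top_linorder by blast
  \<comment> \<open>The open ball of radius \<open>?m + 1\<close> contains both \<open>?m\<close>
    and \<open>- ?m\<close>, which forces the box past \<open>a\<close> on the left and past
    \<open>N\<close> on the right.\<close>
  let ?m = "\<bar>a\<bar> + \<bar>N\<bar>"
  show "\<exists>B>0. \<forall>c d. ball 0 B \<subseteq> cbox c d \<longrightarrow>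
     norm (integral (cbox c d) (\<lambda>x. if x \<in> {a..} then f x else 0) - L) < e"
  proof (intro exI[of _ "?m + 1"] conjI allI impI)
    fix c d :: real assume sub: "ball 0 (?m + 1) \<subseteq> cbox c d"
    have "?m \<in> cbox c d" "- ?m \<in> cbox c d"
      by (rule subsetD[OF sub], simp)+
    then have cd: "c \<le> a" "N \<le> d" by auto
    then have *: "{a..d} = {a..} \<inter> cbox c d" by auto
    have "integral (cbox c d) (\<lambda>x. if x \<in> {a..} then f x else 0) = integral {a..d} f"
      unfolding * by (rule integral_restrict_Int)
    then show "norm (integral (cbox c d) (\<lambda>x. if x \<in> {a..} then f x else 0) - L) < e"
      using N[of d] cd by (simp add: dist_norm)
  qed simp
qed

lemma has_vector_derivative_iff_quotient:
  fixes f :: "real \<Rightarrow> 'a::real_normed_vector"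
  shows "(f has_vector_derivative D) (at x) \<longleftrightarrow> ((\<lambda>h. (f (x + h) - f x) /\<^sub>R h) \<longlongrightarrow> D) (at 0)"
proof -
  have eq: "norm (f (x + h) - f x - h *\<^sub>R D) / norm h = norm ((f (x + h) - f x) /\<^sub>R h - D)"
    if "h \<noteq> 0" for h
  proof -
    have "(f (x + h) - f x) /\<^sub>R h - D = (f (x + h) - f x - h *\<^sub>R D) /\<^sub>R h"
      using that by (simp add: scaleR_diff_right)
    then show ?thesis by (simp add: divide_inverse mult.commute)
  qed
  have "(f has_vector_derivative D) (at x) \<longleftrightarrow>
      ((\<lambda>h. norm (f (x + h) - f x - h *\<^sub>R D) / norm h) \<longlongrightarrow> 0) (at 0)"
    by (simp add: has_vector_derivative_def has_derivative_at bounded_linear_scaleR_left)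
  also have "\<dots> \<longleftrightarrow> ((\<lambda>h. norm ((f (x + h) - f x) /\<^sub>R h - D)) \<longlongrightarrow> 0) (at 0)"
    by (intro filterlim_cong refl eventually_mono[OF eventually_neq_at_within] eq)
  finally show ?thesis by (simp only: tendsto_norm_zero_iff LIM_zero_iff)
qed

text \<open>The mean value inequality turns the bound on \<open>f'\<close> into the same bound for
  all difference quotients with small increment. Dominated convergence along an arbitrary null
  sequence then moves the limit inside the integral.\<close>

lemma has_vector_derivative_integral_dominated:
  fixes f f' :: "real \<Rightarrow> 'a \<Rightarrow> 'b::{banach, second_countable_topology}"
  assumes "e > 0"
    and int: "\<And>s. \<bar>s - s0\<bar> < e \<Longrightarrow> integrable M (f s)"
    and meas: "f' s0 \<in> borel_measurable M"
    and der: "\<And>s y. \<bar>s - s0\<bar> < e \<Longrightarrow> y \<in> space M \<Longrightarrow> ((\<lambda>s. f s y) has_vector_derivative f' s y) (at s)"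
    and bound: "\<And>s y. \<bar>s - s0\<bar> < e \<Longrightarrow> y \<in> space M \<Longrightarrow> norm (f' s y) \<le> g y"
    and g: "integrable M g"
  shows "((\<lambda>s. \<integral>y. f s y \<partial>M) has_vector_derivative (\<integral>y. f' s0 y \<partial>M)) (at s0)"
proof -
  let ?q = "\<lambda>h y. (f (s0 + h) y - f s0 y) /\<^sub>R h"
  have quot: "norm (?q h y) \<le> g y" if h: "\<bar>h\<bar> < e" "h \<noteq> 0" and y: "y \<in> space M" for h y
  proof -
    have "norm (f (s0 + h) y - f s0 y) \<le> g y * norm (s0 + h - s0)"
    proof (rule differentiable_bound[where S = "{s0 - \<bar>h\<bar>..s0 + \<bar>h\<bar>}"])
      fix s assume "s \<in> {s0 - \<bar>h\<bar>..s0 + \<bar>h\<bar>}"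
      then have s: "\<bar>s - s0\<bar> < e" using h by auto
      show "((\<lambda>s. f s y) has_derivative (\<lambda>h. h *\<^sub>R f' s y)) (at s within {s0 - \<bar>h\<bar>..s0 + \<bar>h\<bar>})"
        using der[OF s y] by (simp add: has_vector_derivative_def has_derivative_at_withinI)
      show "onorm (\<lambda>h. h *\<^sub>R f' s y) \<le> g y"
        using bound[OF s y] by (simp add: onorm_scaleR_left onorm_id)
    qed auto
    then show ?thesis using h by (simp add: divide_inverse_commute[symmetric] pos_divide_le_eq mult.commute)
  qed
  have lim_q: "((\<lambda>h. ?q h y) \<longlongrightarrow> f' s0 y) (at 0)" if "y \<in> space M" for y
    using der[of s0 y] \<open>e > 0\<close> that by (simp add: has_vector_derivative_iff_quotient)
  let ?I = "\<lambda>s. \<integral>y. f s y \<partial>M"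
  have "((\<lambda>h. (?I (s0 + h) - ?I s0) /\<^sub>R h) \<longlongrightarrow> (\<integral>y. f' s0 y \<partial>M)) (at 0)"
    unfolding tendsto_at_iff_sequentially comp_def
  proof (intro allI impI)
    fix X :: "nat \<Rightarrow> real" assume X0: "\<forall>i. X i \<in> UNIV - {0}" and X: "X \<longlonglongrightarrow> 0"
    \<comment> \<open>The quotients are dominated only for increments below \<open>e\<close>, so the
      argument runs on a tail of the sequence and the offset is removed at the end.\<close>
    obtain N where N: "\<And>n. n \<ge> N \<Longrightarrow> \<bar>X n\<bar> < e"
      using LIMSEQ_D[OF X \<open>e > 0\<close>] by auto
    have "(\<lambda>n. \<integral>y. ?q (X (n + N)) y \<partial>M) \<longlonglongrightarrow> (\<integral>y. f' s0 y \<partial>M)"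
    proof (rule integral_dominated_convergence[OF meas _ g])
      fix n
      show "AE y in M. norm (?q (X (n + N)) y) \<le> g y"
        using X0 by (intro AE_I2 quot N) auto
      show "?q (X (n + N)) \<in> borel_measurable M"
        using int[of "s0 + X (n + N)"] int[of s0] N[of "n + N"] \<open>e > 0\<close>
        by (intro borel_measurable_scaleR borel_measurable_diff borel_measurable_const) auto
    next
      show "AE y in M. (\<lambda>n. ?q (X (n + N)) y) \<longlonglongrightarrow> f' s0 y"
      proof (rule AE_I2)
        fix y assume "y \<in> space M"
        from lim_q[OF this] have "(\<lambda>n. ?q (X n) y) \<longlonglongrightarrow> f' s0 y"
          using X X0 unfolding tendsto_at_iff_sequentially comp_def by blast
        then show "(\<lambda>n. ?q (X (n + N)) y) \<longlonglongrightarrow> f' s0 y" by (rule LIMSEQ_ignore_initial_segment)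
      qed
    qed
    also have "(\<lambda>n. \<integral>y. ?q (X (n + N)) y \<partial>M) = (\<lambda>n. (?I (s0 + X (n + N)) - ?I s0) /\<^sub>R X (n + N))"
    proof
      fix n
      have "integrable M (f (s0 + X (n + N)))" "integrable M (f s0)"
        using int[of "s0 + X (n + N)"] int[of s0] N[of "n + N"] \<open>e > 0\<close> by auto
      then show "(\<integral>y. ?q (X (n + N)) y \<partial>M) = (?I (s0 + X (n + N)) - ?I s0) /\<^sub>R X (n + N)"
        by (simp add: integral_diff)
    qed
    finally show "(\<lambda>n. (?I (s0 + X n) - ?I s0) /\<^sub>R X n) \<longlonglongrightarrow> (\<integral>y. f' s0 y \<partial>M)"
      by (rule LIMSEQ_offset)
  qed
  then show ?thesis by (simp only: has_vector_derivative_iff_quotient)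
qed

subsection \<open>Moments along the rotated ray\<close>

lemma set_integrable_exp_minus: "set_integrable lborel {0..} (\<lambda>y::real. exp (- y))"
  using has_bochner_integral_I0i_power_exp_m'[of 0]
  by (auto dest!: integrable.intros simp: set_integrable_def mult.commute)

text \<open>Cubic decay beats any power and any linear growth in the exponent. One majorant of the
  form \<open>C * exp (- y)\<close> then serves for all orders \<open>n\<close>.\<close>

lemma cubic_exp_bound:
  fixes t a :: real
  assumes "t > 0"
  shows "\<exists>C. \<forall>y\<ge>0. y ^ n * exp (a * y - t * y ^ 3) \<le> C * exp (- y)"
proof (intro exI allI impI)
  fix y :: real assume y: "y \<ge> 0"
  \<comment> \<open>Of the extra 2, one unit absorbs the \<open>exp y\<close> that bounds the power,
    and the other leaves the factor \<open>exp (- y)\<close>.\<close>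
  let ?c = "\<bar>a + 2\<bar>"
  have "y ^ n / fact n \<le> exp y"
    using sum_le_suminf[of "\<lambda>n. y ^ n /\<^sub>R fact n" "{n}"] exp_converges[of y] y
    by (auto simp: sums_iff divide_inverse mult.commute)
  then have pow: "y ^ n \<le> fact n * exp y"
    by (simp add: field_simps)
  \<comment> \<open>The point \<open>sqrt (?c / t)\<close> is where the cubic overtakes the linear
    term: before it the linear term is bounded by its value there, after it the difference is
    nonpositive.\<close>
  have "?c * y - t * y ^ 3 \<le> ?c * sqrt (?c / t)"
  proof (cases "y \<le> sqrt (?c / t)")
    case True
    then have "?c * y \<le> ?c * sqrt (?c / t)" by (intro mult_left_mono) auto
    moreover have "0 \<le> t * y ^ 3" using assms y by simp
    ultimately show ?thesis by linarith
  next
    case False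
    then have "?c / t \<le> y ^ 2" by (meson not_le less_imp_le real_le_lsqrt real_less_lsqrt sqrt_le_D)
    then have "?c * y \<le> (t * y ^ 2) * y"
      using assms y by (intro mult_right_mono) (auto simp: field_simps)
    moreover have "0 \<le> ?c * sqrt (?c / t)" using assms by simp
    ultimately show ?thesis by (simp add: power3_eq_cube power2_eq_square mult.assoc)
  qed
  moreover have "(a + 2) * y \<le> ?c * y" using y by (intro mult_right_mono) auto
  ultimately have "exp (y + (a * y - t * y ^ 3)) \<le> exp (?c * sqrt (?c / t) - y)"
    by (simp add: algebra_simps)
  moreover have "y ^ n * exp (a * y - t * y ^ 3) \<le> fact n * exp y * exp (a * y - t * y ^ 3)"
    by (intro mult_right_mono pow) auto
  moreover have "fact n * exp y * exp (a * y - t * y ^ 3) = fact n * exp (y + (a * y - t * y ^ 3))"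
    by (simp only: exp_add mult.assoc)
  moreover have "fact n * exp (y + (a * y - t * y ^ 3)) \<le> fact n * exp (?c * sqrt (?c / t) - y)"
    using calculation(1) by (intro mult_left_mono) auto
  moreover have "fact n * exp (?c * sqrt (?c / t) - y) = fact n * exp (?c * sqrt (?c / t)) * exp (- y)"
    by (simp add: exp_diff exp_minus field_simps)
  ultimately show "y ^ n * exp (a * y - t * y ^ 3) \<le> fact n * exp (?c * sqrt (?c / t)) * exp (- y)"
    by linarith
qed

text \<open>This is the unit \<open>exp (\<i> * pi / 6)\<close>, a cube root of
  \<open>\<i>\<close>.\<close>

definition airy_root :: complex where
  "airy_root = Complex (sqrt 3 / 2) (1 / 2)"

lemma airy_root_cubed: "airy_root ^ 3 = \<i>"
  by (simp add: airy_root_def power3_eq_cube complex_eq_iff algebra_simps)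

text \<open>The last argument is complex so that the contour can be moved off the real axis.\<close>

definition airy_phase :: "real \<Rightarrow> real \<Rightarrow> complex \<Rightarrow> complex" where
  "airy_phase x t z = exp (\<i> * (of_real x * z + of_real t * z ^ 3))"

text \<open>The Jacobian \<open>airy_root\<close> of the parametrised ray is left out here and
  reappears in front of the moments. The power of \<open>y\<close> records derivatives: one for each
  derivative in \<open>x\<close>, three for each in \<open>t\<close>.\<close>

definition airy_kernel :: "nat \<Rightarrow> real \<Rightarrow> real \<Rightarrow> real \<Rightarrow> complex" where
  "airy_kernel n x t y = of_real y ^ n * airy_phase x t (airy_root * of_real y)"

definition airy_moment :: "nat \<Rightarrow> real \<Rightarrow> real \<Rightarrow> complex" where
  "airy_moment n x t = (LBINT y:{0..}. airy_kernel n x t y)"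

text \<open>The real part is the damping and the imaginary part the oscillation that appear in the
  final real integral; the term in \<open>t\<close> is purely real because \<open>airy_root\<close>
  cubes to \<open>\<i>\<close>.\<close>

lemma airy_exponent:
  "\<i> * (of_real x * (airy_root * of_real y) + of_real t * (airy_root * of_real y) ^ 3) =
     Complex (- (x * y / 2) - t * y ^ 3) (sqrt 3 / 2 * x * y)"
  by (simp add: power_mult_distrib airy_root_cubed) (simp add: airy_root_def complex_eq_iff algebra_simps)

lemma norm_airy_kernel:
  "y \<ge> 0 \<Longrightarrow> norm (airy_kernel n x t y) = y ^ n * exp (- (x * y / 2) - t * y ^ 3)"
  unfolding airy_kernel_def airy_phase_def airy_exponent by (simp add: norm_mult norm_power)

lemma continuous_on_airy_kernel: "continuous_on A (airy_kernel n x t)"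
  unfolding airy_kernel_def airy_phase_def by (intro continuous_intros)

text \<open>By monotonicity the worst case is \<open>x = - L\<close> and \<open>t = t0\<close>, so a
  single constant covers the whole range. This locally uniform bound is what differentiation in
  \<open>x\<close> and in \<open>t\<close> rests on.\<close>

lemma airy_kernel_bound:
  assumes "t0 > 0"
  shows "\<exists>C. \<forall>x t y. \<bar>x\<bar> \<le> L \<longrightarrow> t \<ge> t0 \<longrightarrow> y \<ge> 0 \<longrightarrow> norm (airy_kernel n x t y) \<le> C * exp (- y)"
proof -
  obtain C where C: "\<And>y. y \<ge> 0 \<Longrightarrow> y ^ n * exp (L / 2 * y - t0 * y ^ 3) \<le> C * exp (- y)"
    using cubic_exp_bound[OF assms] by metis
  have "norm (airy_kernel n x t y) \<le> C * exp (- y)" if "\<bar>x\<bar> \<le> L" "t \<ge> t0" "y \<ge> 0" for x t y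
  proof -
    have "- x * y \<le> L * y" "t0 * y ^ 3 \<le> t * y ^ 3"
      using that by (intro mult_right_mono; simp)+
    then have "y ^ n * exp (- (x * y / 2) - t * y ^ 3) \<le> y ^ n * exp (L / 2 * y - t0 * y ^ 3)"
      using that by (intro mult_left_mono) auto
    then show ?thesis using C[of y] that by (simp add: norm_airy_kernel)
  qed
  then show ?thesis by blast
qed

lemma set_integrable_dominated_exp:
  fixes f :: "real \<Rightarrow> 'a::{banach, second_countable_topology}"
  assumes "continuous_on {0..} f" and "\<And>y. y \<ge> 0 \<Longrightarrow> norm (f y) \<le> C * exp (- y)"
  shows "set_integrable lborel {0..} f"
  unfolding set_integrable_def
proof (rule Bochner_Integration.integrable_bound)
  show "integrable lborel (\<lambda>y. indicator {0..} y *\<^sub>R (C * exp (- y)))"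
    using set_integrable_mult_right[of C, OF set_integrable_exp_minus] by (simp add: set_integrable_def)
  show "(\<lambda>y. indicator {0..} y *\<^sub>R f y) \<in> borel_measurable lborel"
    using borel_measurable_continuous_on_indicator[OF _ assms(1)] by simp
  show "AE y in lborel. norm (indicator {0..} y *\<^sub>R f y) \<le> norm (indicator {0..} y *\<^sub>R (C * exp (- y)))"
    using assms(2) by (auto split: split_indicator intro!: order_trans[OF _ abs_ge_self])
qed

lemma set_integrable_airy_kernel:
  assumes "t > 0" shows "set_integrable lborel {0..} (airy_kernel n x t)"
  using airy_kernel_bound[OF assms, of "\<bar>x\<bar>" n]
  by (auto intro: set_integrable_dominated_exp continuous_on_airy_kernel)

lemma integrable_exp_dominator: "integrable lborel (\<lambda>y::real. indicator {0..} y * (C * exp (- y)))"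
  using set_integrable_mult_right[of C, OF set_integrable_exp_minus] by (simp add: set_integrable_def)

lemma airy_kernel_deriv_x:
  "((\<lambda>x. airy_kernel n x t y) has_vector_derivative \<i> * airy_root * airy_kernel (Suc n) x t y) (at x)"
  unfolding airy_kernel_def airy_phase_def
  by (rule has_vector_derivative_real_field[where f = "\<lambda>x. of_real y ^ n *
       exp (\<i> * (x * (airy_root * of_real y) + of_real t * (airy_root * of_real y) ^ 3))"])
     (auto intro!: derivative_eq_intros simp: algebra_simps)

text \<open>The time factor \<open>\<i> * (airy_root * y) ^ 3\<close> collapses to
  \<open>- y ^ 3\<close>: one time derivative raises the order by three, with a sign but no power of
  \<open>airy_root\<close>.\<close>

lemma airy_kernel_deriv_t:
  "((\<lambda>t. airy_kernel n x t y) has_vector_derivative - airy_kernel (n + 3) x t y) (at t)"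
  unfolding airy_kernel_def airy_phase_def
  by (rule has_vector_derivative_real_field[where f = "\<lambda>t. of_real y ^ n *
       exp (\<i> * (of_real x * (airy_root * of_real y) + t * (airy_root * of_real y) ^ 3))"])
     (auto intro!: derivative_eq_intros simp: power_mult_distrib airy_root_cubed power_add algebra_simps)

lemma airy_moment_deriv_x:
  assumes "t > 0"
  shows "((\<lambda>x. airy_moment n x t) has_vector_derivative \<i> * airy_root * airy_moment (Suc n) x t) (at x)"
proof -
  obtain C where C: "\<And>s y. \<bar>s\<bar> \<le> \<bar>x\<bar> + 1 \<Longrightarrow> y \<ge> 0 \<Longrightarrow> norm (airy_kernel (Suc n) s t y) \<le> C * exp (- y)"
    using airy_kernel_bound[OF assms, of "\<bar>x\<bar> + 1" "Suc n"] by blast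
  have "((\<lambda>s. \<integral>y. indicator {0..} y *\<^sub>R airy_kernel n s t y \<partial>lborel) has_vector_derivative
     (\<integral>y. indicator {0..} y *\<^sub>R (\<i> * airy_root * airy_kernel (Suc n) x t y) \<partial>lborel)) (at x)"
  proof (rule has_vector_derivative_integral_dominated[where e = 1 and
        g = "\<lambda>y. indicator {0..} y * (norm airy_root * C * exp (- y))"])
    fix s y assume s: "\<bar>s - x\<bar> < 1"
    show "integrable lborel (\<lambda>y. indicator {0..} y *\<^sub>R airy_kernel n s t y)"
      using set_integrable_airy_kernel[OF assms] by (simp add: set_integrable_def)
    show "((\<lambda>s. indicator {0..} y *\<^sub>R airy_kernel n s t y) has_vector_derivative
          indicator {0..} y *\<^sub>R (\<i> * airy_root * airy_kernel (Suc n) s t y)) (at s)"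
      by (intro bounded_linear.has_vector_derivative[OF bounded_linear_scaleR_right] airy_kernel_deriv_x)
    show "norm (indicator {0..} y *\<^sub>R (\<i> * airy_root * airy_kernel (Suc n) s t y))
          \<le> indicator {0..} y * (norm airy_root * C * exp (- y))"
      using C[of s y] s by (auto simp: norm_mult mult_left_mono mult.assoc split: split_indicator)
  next
    show "(\<lambda>y. indicator {0..} y *\<^sub>R (\<i> * airy_root * airy_kernel (Suc n) x t y)) \<in> borel_measurable lborel"
      using borel_measurable_continuous_on_indicator[of "{0..}" "\<lambda>y. \<i> * airy_root * airy_kernel (Suc n) x t y"]
      by (simp add: continuous_on_mult_left continuous_on_airy_kernel)
  qed (auto simp: integrable_exp_dominator)
  then show ?thesis
    by (simp add: airy_moment_def set_integral_mult_right flip: set_lebesgue_integral_def)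
qed

lemma airy_moment_deriv_t:
  assumes "t > 0"
  shows "((\<lambda>t. airy_moment n x t) has_vector_derivative - airy_moment (n + 3) x t) (at t)"
proof -
  \<comment> \<open>Staying within \<open>t / 2\<close> of \<open>t\<close> keeps the time away from
    0, where domination would fail.\<close>
  obtain C where C: "\<And>s y. t / 2 \<le> s \<Longrightarrow> y \<ge> 0 \<Longrightarrow> norm (airy_kernel (n + 3) x s y) \<le> C * exp (- y)"
    using airy_kernel_bound[of "t / 2" "\<bar>x\<bar>" "n + 3"] assms by auto
  have "((\<lambda>s. \<integral>y. indicator {0..} y *\<^sub>R airy_kernel n x s y \<partial>lborel) has_vector_derivative
     (\<integral>y. indicator {0..} y *\<^sub>R (- airy_kernel (n + 3) x t y) \<partial>lborel)) (at t)"
  proof (rule has_vector_derivative_integral_dominated[where e = "t / 2" and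
        g = "\<lambda>y. indicator {0..} y * (C * exp (- y))"])
    fix s y assume s: "\<bar>s - t\<bar> < t / 2"
    then have s': "t / 2 \<le> s" "s > 0" by (auto simp: abs_if split: if_splits)
    show "integrable lborel (\<lambda>y. indicator {0..} y *\<^sub>R airy_kernel n x s y)"
      using set_integrable_airy_kernel[OF s'(2)] by (simp add: set_integrable_def)
    show "((\<lambda>s. indicator {0..} y *\<^sub>R airy_kernel n x s y) has_vector_derivative
          indicator {0..} y *\<^sub>R (- airy_kernel (n + 3) x s y)) (at s)"
      by (intro bounded_linear.has_vector_derivative[OF bounded_linear_scaleR_right] airy_kernel_deriv_t)
    show "norm (indicator {0..} y *\<^sub>R (- airy_kernel (n + 3) x s y))
          \<le> indicator {0..} y * (C * exp (- y))"
      using C[OF s'(1), of y] by (auto split: split_indicator)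
  next
    show "(\<lambda>y. indicator {0..} y *\<^sub>R (- airy_kernel (n + 3) x t y)) \<in> borel_measurable lborel"
      using borel_measurable_continuous_on_indicator[of "{0..}" "\<lambda>y. - airy_kernel (n + 3) x t y"]
      by (simp add: continuous_on_minus continuous_on_airy_kernel)
  qed (use assms in \<open>auto simp: integrable_exp_dominator\<close>)
  then show ?thesis
    by (simp add: airy_moment_def set_lebesgue_integral_def)
qed

subsection \<open>Rotation of the contour\<close>

lemma airy_phase_real:
  "airy_phase x t (of_real \<beta>) = cis (x * \<beta> + t * \<beta> ^ 3)"
  by (simp add: airy_phase_def cis_conv_exp)

lemma continuous_on_airy_phase: "continuous_on A (airy_phase x t)"
  unfolding airy_phase_def by (intro continuous_intros)

lemma norm_airy_phase_vertical:
  "norm (airy_phase x t (of_real R + \<i> * of_real s)) = exp (- x * s - t * (3 * R\<^sup>2 * s - s ^ 3))"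
  by (simp add: airy_phase_def power3_eq_cube power2_eq_square algebra_simps)

text \<open>Cauchy's theorem on the triangle with vertices \<open>0\<close>, \<open>R\<close> and \<open>R + \<i>R/\<surd>3\<close>.\<close>

lemma airy_phase_truncation_error:
  assumes "t > 0" "R > 0" and k: "k = 8 / 3 * t * R\<^sup>2 - \<bar>x\<bar>" "k > 0"
  shows "norm (integral {0..R} (\<lambda>\<beta>. airy_phase x t (of_real \<beta>)) -
      airy_root * integral {0..2 * R / sqrt 3} (airy_kernel 0 x t)) \<le> 1 / k"
proof -
  have "airy_phase x t holomorphic_on UNIV"
    \<comment> \<open>The phase is entire, so it has a global primitive \<open>F\<close>, and
      closing up the triangle amounts to cancelling values of \<open>F\<close> at its
      vertices.\<close>
    unfolding airy_phase_def by (intro holomorphic_intros)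
  then obtain F where F: "\<And>z. (F has_field_derivative airy_phase x t z) (at z)"
    using holomorphic_convex_primitive'[of UNIV "airy_phase x t"] by auto
  \<comment> \<open>One formula for a segment from \<open>a\<close> in direction \<open>c\<close>;
    it is used with \<open>c\<close> equal to 1, \<open>airy_root\<close> and \<open>\<i>\<close>
    for the three sides.\<close>
  have path: "((\<lambda>s. c * airy_phase x t (a + c * of_real s)) has_integral (F (a + c * of_real b) - F a)) {0..b}"
    if "b \<ge> 0" for a b c
  proof -
    have "((\<lambda>s. F (a + c * of_real s)) has_vector_derivative c * airy_phase x t (a + c * of_real s)) (at s within {0..b})" for s
    proof (rule has_vector_derivative_real_field[where f = "\<lambda>s. F (a + c * s)"])
      have "((\<lambda>s. F (a + c * s)) has_field_derivative airy_phase x t (a + c * of_real s) * c) (at (of_real s))"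
        by (rule DERIV_chain2[OF F]) (auto intro!: derivative_eq_intros)
      then show "((\<lambda>s. F (a + c * s)) has_field_derivative c * airy_phase x t (a + c * of_real s)) (at (of_real s))"
        by (simp add: mult.commute)
    qed
    from fundamental_theorem_of_calculus[OF that this] show ?thesis by simp
  qed
  have R: "integral {0..R} (\<lambda>\<beta>. airy_phase x t (of_real \<beta>)) = F (of_real R) - F 0"
    using path[of R 1 0] \<open>R > 0\<close> by (simp add: integral_unique)
  have W: "airy_root * integral {0..2 * R / sqrt 3} (airy_kernel 0 x t) =
      F (airy_root * of_real (2 * R / sqrt 3)) - F 0"
    using path[of "2 * R / sqrt 3" airy_root 0] \<open>R > 0\<close>
    by (simp add: airy_kernel_def integral_unique flip: integral_mult_right)
  \<comment> \<open>The ray has length \<open>R\<close> divided by the cosine of its angle, so that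
    it ends vertically above \<open>R\<close>.\<close>
  have corner: "airy_root * of_real (2 * R / sqrt 3) = of_real R + \<i> * of_real (R / sqrt 3)"
    by (simp add: airy_root_def complex_eq_iff field_simps)
  let ?g = "\<lambda>s. \<i> * airy_phase x t (of_real R + \<i> * of_real s)"
  let ?S = "R / sqrt 3"
  have S: "?S \<ge> 0" using \<open>R > 0\<close> by simp
  have V: "(?g has_integral (F (of_real R + \<i> * of_real ?S) - F (of_real R))) {0..?S}"
    by (rule path[OF S])
  have E: "((\<lambda>s. exp (- k * s)) has_integral (- exp (- k * ?S) / k - (- exp (- k * 0) / k))) {0..?S}"
    using S \<open>k > 0\<close>
    by (intro fundamental_theorem_of_calculus)
       (auto intro!: derivative_eq_intros simp flip: has_real_derivative_iff_has_vector_derivative)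
  have "norm (integral {0..?S} ?g) \<le> integral {0..?S} (\<lambda>s. exp (- k * s))"
  proof (rule integral_norm_bound_integral)
    \<comment> \<open>On the vertical side \<open>s ^ 3\<close> is at most
      \<open>s * R^2 / 3\<close>, so the cubic part of the decay is at least
      \<open>8 / 3 * t * R^2 * s\<close>. This is the origin of the constant in
      \<open>k\<close>.\<close>
    fix s assume s: "s \<in> {0..?S}"
    then have "s\<^sup>2 \<le> ?S\<^sup>2" by (intro power_mono) auto
    then have "s\<^sup>2 \<le> R\<^sup>2 / 3" by (simp add: power_divide)
    then have "s * s\<^sup>2 \<le> s * (R\<^sup>2 / 3)" using s by (intro mult_left_mono) auto
    then have "t * (8 / 3 * R\<^sup>2 * s) \<le> t * (3 * R\<^sup>2 * s - s ^ 3)"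
      using \<open>t > 0\<close> by (intro mult_left_mono) (auto simp: power3_eq_cube power2_eq_square algebra_simps)
    moreover have "- x * s \<le> \<bar>x\<bar> * s" using s by (intro mult_right_mono) auto
    ultimately have "- x * s - t * (3 * R\<^sup>2 * s - s ^ 3) \<le> - k * s"
      by (simp add: k algebra_simps)
    then show "norm (?g s) \<le> exp (- k * s)"
      by (simp add: norm_mult norm_airy_phase_vertical)
  qed (use V E in \<open>auto simp: integrable_on_def\<close>)
  also have "\<dots> \<le> 1 / k"
    using E \<open>k > 0\<close> by (simp add: integral_unique field_simps)
  finally have "norm (F (of_real R + \<i> * of_real ?S) - F (of_real R)) \<le> 1 / k"
    by (simp only: integral_unique[OF V])
  then show ?thesis
    unfolding R W corner by (simp add: norm_minus_commute)
qed

lemma airy_kernel_integral_tendsto: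
  assumes "t > 0"
  shows "((\<lambda>S. integral {0..S} (airy_kernel n x t)) \<longlongrightarrow> airy_moment n x t) at_top"
proof -
  have "(LBINT y:{0..S}. airy_kernel n x t y) = integral {0..S} (airy_kernel n x t)" for S
    by (rule set_borel_integral_eq_integral)
       (rule set_integrable_subset[OF set_integrable_airy_kernel[OF assms]], auto)
  then show ?thesis
    using tendsto_set_lebesgue_integral_at_top[of 0 lborel, OF _ set_integrable_airy_kernel[OF assms, of n x]]
    by (simp add: airy_moment_def)
qed

text \<open>The contribution of the vertical side is at most \<open>1 / k\<close> with
  \<open>k\<close> of order \<open>R^2\<close>, so it disappears; the ray integral converges
  absolutely, and its longer truncation point does not change the limit.\<close>

lemma airy_phase_integral_tendsto:
  assumes "t > 0"
  shows "((\<lambda>R. integral {0..R} (\<lambda>\<beta>. airy_phase x t (of_real \<beta>))) \<longlongrightarrow> airy_root * airy_moment 0 x t) at_top"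
proof -
  let ?A = "\<lambda>R. integral {0..R} (\<lambda>\<beta>. airy_phase x t (of_real \<beta>))"
  let ?B = "\<lambda>R. airy_root * integral {0..2 * R / sqrt 3} (airy_kernel 0 x t)"
  let ?k = "\<lambda>R. 8 / 3 * t * R\<^sup>2 - \<bar>x\<bar>"
  have k: "filterlim ?k at_top at_top"
    using assms by real_asymp
  have "eventually (\<lambda>R. norm (?A R - ?B R) \<le> 1 / ?k R) at_top"
    using filterlim_at_top_dense[THEN iffD1, OF k, rule_format, of 0] eventually_gt_at_top[of 0]
    by eventually_elim (auto intro: airy_phase_truncation_error[OF assms])
  moreover have "((\<lambda>R. 1 / ?k R) \<longlongrightarrow> 0) at_top"
    by (intro tendsto_divide_0[OF tendsto_const] filterlim_at_top_imp_at_infinity k)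
  ultimately have "((\<lambda>R. ?A R - ?B R) \<longlongrightarrow> 0) at_top"
    by (rule Lim_null_comparison)
  moreover have "(?B \<longlongrightarrow> airy_root * airy_moment 0 x t) at_top"
  proof (intro tendsto_mult tendsto_const filterlim_compose[OF airy_kernel_integral_tendsto[OF assms]])
    show "filterlim (\<lambda>R. 2 * R / sqrt 3) at_top at_top"
      using filterlim_tendsto_pos_mult_at_top[of "\<lambda>_. 2 / sqrt 3" "2 / sqrt 3" at_top "\<lambda>R::real. R"]
      by (simp add: filterlim_ident)
  qed
  ultimately show ?thesis using tendsto_add by fastforce
qed

lemma airy_phase_has_integral:
  assumes "t > 0"
  shows "((\<lambda>\<beta>. airy_phase x t (of_real \<beta>)) has_integral airy_root * airy_moment 0 x t) {0..}"
  using airy_phase_integral_tendsto[OF assms]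
  by (intro has_integral_atLeast_tendsto integrable_continuous_interval
      continuous_on_compose2[OF continuous_on_airy_phase[of UNIV]] continuous_intros) auto

subsection \<open>Representations of the fundamental solution\<close>

text \<open>Balls around 0 are symmetric, so the radius that works for \<open>f\<close> also works
  for its reflection.\<close>

lemma has_integral_reflect_atMost:
  fixes f :: "real \<Rightarrow> 'a::banach"
  assumes "(f has_integral L) {a..}"
  shows "((\<lambda>x. f (- x)) has_integral L) {..- a}"
  unfolding has_integral_alt'
proof (intro conjI allI impI)
  note f = assms[unfolded has_integral_alt']
  let ?f = "\<lambda>x. if x \<in> {a..} then f x else 0"
  have eq: "(\<lambda>x. if x \<in> {..- a} then f (- x) else 0) = (\<lambda>x. ?f (- x))"
    by (auto intro!: ext)
  fix c d :: real
  show "(\<lambda>x. if x \<in> {..- a} then f (- x) else 0) integrable_on cbox c d"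
    unfolding eq using f integrable_reflect[of ?f "- c" "- d"] by simp
next
  note f = assms[unfolded has_integral_alt']
  let ?f = "\<lambda>x. if x \<in> {a..} then f x else 0"
  have eq: "(\<lambda>x. if x \<in> {..- a} then f (- x) else 0) = (\<lambda>x. ?f (- x))"
    by (auto intro!: ext)
  fix e :: real assume "e > 0"
  with f obtain B where "B > 0" and
    B: "\<And>c d. ball 0 B \<subseteq> cbox c d \<Longrightarrow> norm (integral (cbox c d) ?f - L) < e" by blast
  have "norm (integral (cbox c d) (\<lambda>x. ?f (- x)) - L) < e" if "ball 0 B \<subseteq> cbox c d" for c d :: real
  proof -
    have "x \<in> cbox (- d) (- c)" if "x \<in> ball 0 B" for x
      using subsetD[OF \<open>ball 0 B \<subseteq> cbox c d\<close>, of "- x"] that by auto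
    then have "norm (integral (cbox (- d) (- c)) ?f - L) < e" by (intro B) auto
    then show ?thesis using integral_reflect[of "- c" "- d" ?f] by simp
  qed
  then show "\<exists>B>0. \<forall>c d. ball 0 B \<subseteq> cbox c d \<longrightarrow>
      norm (integral (cbox c d) (\<lambda>x. if x \<in> {..- a} then f (- x) else 0) - L) < e"
    unfolding eq using \<open>B > 0\<close> by blast
qed

text \<open>The phase is odd in \<beta>, hence reflecting \<beta> conjugates the integrand. The two
  half-lines contribute conjugate values, and their sum is twice a real part.\<close>

lemma fundamental_solution_has_integral:
  assumes "t > 0"
  shows "((\<lambda>\<beta>::real. exp (- (\<i> * of_real \<beta> * of_real x) - \<i> * of_real t * of_real \<beta> ^ 3) :: complex)
     has_integral of_real (2 * Re (airy_root * airy_moment 0 x t))) UNIV"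
proof -
  let ?f = "\<lambda>\<beta>::real. airy_phase x t (of_real \<beta>)"
  have "(\<lambda>\<beta>::real. exp (- (\<i> * of_real \<beta> * of_real x) - \<i> * of_real t * of_real \<beta> ^ 3) :: complex) = (\<lambda>\<beta>. ?f (- \<beta>))"
    by (auto simp: airy_phase_def fun_eq_iff algebra_simps)
  moreover have "(\<lambda>\<beta>. ?f (- \<beta>)) = (\<lambda>\<beta>. cnj (?f \<beta>))"
    unfolding airy_phase_real by (simp add: cis_cnj fun_eq_iff)
  moreover have "((\<lambda>\<beta>. ?f (- \<beta>)) has_integral airy_root * airy_moment 0 x t) {..0}"
    using has_integral_reflect_atMost[OF airy_phase_has_integral[OF assms]] by simp
  moreover have "((\<lambda>\<beta>. cnj (?f \<beta>)) has_integral cnj (airy_root * airy_moment 0 x t)) {0..}"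
    by (rule has_integral_linear[OF airy_phase_has_integral[OF assms] bounded_linear_cnj, unfolded comp_def])
  moreover have "{..0} \<inter> {0..} = {0::real}" "{..0} \<union> {0..} = (UNIV :: real set)" by auto
  ultimately show ?thesis
    using has_integral_Un[of "\<lambda>\<beta>. ?f (- \<beta>)" "airy_root * airy_moment 0 x t" "{..0}"
        "cnj (airy_root * airy_moment 0 x t)" "{0..}"]
    by (simp add: complex_add_cnj del: complex_cnj_mult)
qed

lemma u3_eq_moment:
  assumes "t > 0"
  shows "u3 x t = of_real (Re (airy_root * airy_moment 0 x t) / pi)"
proof -
  have "1 / (2 * of_real pi) * complex_of_real (2 * r) = of_real (r / pi)" for r by simp
  then show ?thesis
    unfolding u3_def integral_unique[OF fundamental_solution_has_integral[OF assms, of x]] .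
qed

text \<open>The Airy integrand is the real part of the phase at time 1/3.\<close>

lemma airy_Ai_eq_moment: "airy_Ai z = Re (airy_root * airy_moment 0 z (1 / 3)) / pi"
proof -
  have "((\<lambda>s. Re (airy_phase z (1 / 3) (of_real s))) has_integral Re (airy_root * airy_moment 0 z (1 / 3))) {0..}"
    by (intro has_integral_Re airy_phase_has_integral) auto
  then have "((\<lambda>s. cos (s ^ 3 / 3 + z * s)) has_integral Re (airy_root * airy_moment 0 z (1 / 3))) {0..}"
    unfolding airy_phase_real by (simp add: add.commute)
  then show ?thesis by (simp add: airy_Ai_def integral_unique)
qed

text \<open>Substituting \<open>c * y\<close> for \<open>y\<close> exploits that the exponent
  depends only on \<open>x * y\<close> and \<open>t * y ^ 3\<close>; the Jacobian gives the
  denominator.\<close>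

lemma airy_moment_scale:
  assumes "c > 0"
  shows "airy_moment 0 x (c ^ 3 * t) = airy_moment 0 (x / c) t / of_real c"
proof -
  have "airy_moment 0 (x / c) t =
      c *\<^sub>R (\<integral>y. indicator {0..} (c * y) *\<^sub>R airy_kernel 0 (x / c) t (c * y) \<partial>lborel)"
    using lborel_integral_real_affine[of c "\<lambda>y. indicator {0..} y *\<^sub>R airy_kernel 0 (x / c) t y" 0] assms
    by (simp add: airy_moment_def set_lebesgue_integral_def)
  also have "(\<lambda>y. indicator {0..} (c * y) *\<^sub>R airy_kernel 0 (x / c) t (c * y)) =
      (\<lambda>y. indicator {0..} y *\<^sub>R airy_kernel 0 x (c ^ 3 * t) y)"
    using assms
    by (auto simp: fun_eq_iff airy_kernel_def airy_phase_def indicator_def zero_le_mult_iff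
        power_mult_distrib mult_ac)
  finally show ?thesis
    using assms by (simp add: airy_moment_def set_lebesgue_integral_def scaleR_conv_of_real)
qed

lemma u3_eq_airy_Ai:
  assumes "t > 0"
  shows "u3 x t = of_real (1 / root 3 (3 * t) * airy_Ai (x / root 3 (3 * t)))"
proof -
  let ?c = "root 3 (3 * t)"
  \<comment> \<open>The scale is chosen so that time 1/3, the time of the Airy function, is carried
    to \<open>t\<close>.\<close>
  have "?c > 0" "?c ^ 3 * (1 / 3) = t" using assms by auto
  then have "airy_moment 0 x t = airy_moment 0 (x / ?c) (1 / 3) / of_real ?c"
    using airy_moment_scale[of ?c x "1 / 3"] by simp
  then show ?thesis
    by (simp add: u3_eq_moment[OF assms] airy_Ai_eq_moment flip: of_real_mult of_real_divide)
qed

text \<open>This integrates the derivative of \<open>airy_kernel 0\<close> along the ray; the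
  boundary values are 0 at infinity and 1 at the origin. It trades the factor \<open>x\<close> on
  the zeroth moment for the second moment, which is where \<open>1 / x\<close> and the weight
  \<open>y^2\<close> come from.\<close>

lemma airy_moment_recurrence:
  assumes "t > 0"
  shows "\<i> * airy_root * of_real x * airy_moment 0 x t - 3 * of_real t * airy_moment 2 x t = - 1"
proof -
  let ?k = "\<lambda>n. airy_kernel n x t"
  have der: "(?k 0 has_vector_derivative \<i> * airy_root * of_real x * ?k 0 y - 3 * of_real t * ?k 2 y) (at y within A)" for y A
    unfolding airy_kernel_def airy_phase_def
    by (rule has_vector_derivative_real_field[where f = "\<lambda>y. y ^ 0 *
        exp (\<i> * (of_real x * (airy_root * y) + of_real t * (airy_root * y) ^ 3))"])
       (auto intro!: derivative_eq_intros simp: power_mult_distrib airy_root_cubed algebra_simps)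
  have int: "?k n integrable_on {0..S}" for n S
    by (intro integrable_continuous_interval continuous_on_airy_kernel)
  have "\<i> * airy_root * of_real x * integral {0..S} (?k 0) - 3 * of_real t * integral {0..S} (?k 2) = ?k 0 S - 1"
    if "S \<ge> 0" for S
  proof -
    have "((\<lambda>y. \<i> * airy_root * of_real x * ?k 0 y - 3 * of_real t * ?k 2 y) has_integral (?k 0 S - ?k 0 0)) {0..S}"
      using that by (intro fundamental_theorem_of_calculus der)
    moreover have "((\<lambda>y. \<i> * airy_root * of_real x * ?k 0 y - 3 * of_real t * ?k 2 y) has_integral
        (\<i> * airy_root * of_real x * integral {0..S} (?k 0) - 3 * of_real t * integral {0..S} (?k 2))) {0..S}"
      by (intro has_integral_diff has_integral_mult_right integrable_integral int)
    ultimately have "\<i> * airy_root * of_real x * integral {0..S} (?k 0) - 3 * of_real t * integral {0..S} (?k 2)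
        = ?k 0 S - ?k 0 0" by (rule has_integral_unique[rotated])
    moreover have "?k 0 0 = 1" by (simp add: airy_kernel_def airy_phase_def)
    ultimately show ?thesis by simp
  qed
  then have "eventually (\<lambda>S. ?k 0 S - 1 = \<i> * airy_root * of_real x * integral {0..S} (?k 0) -
      3 * of_real t * integral {0..S} (?k 2)) at_top"
    by (intro eventually_at_top_linorderI[of 0]) auto
  moreover have "((\<lambda>S. ?k 0 S - 1) \<longlongrightarrow> 0 - 1) at_top"
  proof -
    obtain C where C: "\<And>y. y \<ge> 0 \<Longrightarrow> norm (?k 0 y) \<le> C * exp (- y)"
      using airy_kernel_bound[OF assms, of "\<bar>x\<bar>" 0] by auto
    have "eventually (\<lambda>y. norm (?k 0 y) \<le> C * exp (- y)) at_top"
      using C by (intro eventually_at_top_linorderI[of 0])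
    moreover have "((\<lambda>y. C * exp (- y)) \<longlongrightarrow> 0) at_top" by real_asymp
    ultimately have "(?k 0 \<longlongrightarrow> 0) at_top" by (rule Lim_null_comparison)
    then show ?thesis by (intro tendsto_diff tendsto_const)
  qed
  ultimately have "((\<lambda>S. \<i> * airy_root * of_real x * integral {0..S} (?k 0) -
      3 * of_real t * integral {0..S} (?k 2)) \<longlongrightarrow> 0 - 1) at_top"
    by (rule Lim_transform_eventually[rotated])
  moreover have "((\<lambda>S. \<i> * airy_root * of_real x * integral {0..S} (?k 0) -
      3 * of_real t * integral {0..S} (?k 2)) \<longlongrightarrow>
      \<i> * airy_root * of_real x * airy_moment 0 x t - 3 * of_real t * airy_moment 2 x t) at_top"
    by (intro tendsto_intros airy_kernel_integral_tendsto assms)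
  ultimately show ?thesis
    using tendsto_unique[OF trivial_limit_at_top_linorder] by fastforce
qed

lemma Im_airy_kernel:
  "Im (airy_kernel 2 x t y) = exp (- (x * y / 2)) * sin (sqrt 3 / 2 * x * y) * y\<^sup>2 * exp (- t * y ^ 3)"
proof -
  have "Im (airy_kernel 2 x t y) = y\<^sup>2 * (exp (- (x * y / 2) - t * y ^ 3) * sin (sqrt 3 / 2 * x * y))"
    unfolding airy_kernel_def airy_phase_def airy_exponent by (simp add: Im_exp flip: of_real_power)
  also have "exp (- (x * y / 2) - t * y ^ 3) = exp (- (x * y / 2)) * exp (- t * y ^ 3)"
    by (simp flip: exp_add)
  finally show ?thesis by (simp only: mult_ac)
qed

text \<open>In \<open>airy_moment_recurrence\<close> the right-hand side is real, so taking
  imaginary parts removes it: \<open>x\<close> times the real part that represents \<open>u3\<close>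
  equals \<open>3 * t\<close> times the imaginary part of the second moment.\<close>

lemma
  assumes "t > 0"
  shows set_integrable_rotated: "set_integrable lborel {0<..}
         (\<lambda>y. exp (- (x * y / 2)) * sin (sqrt 3 / 2 * x * y) * y\<^sup>2 * exp (- t * y ^ 3))"
    and u3_eq_rotated: "x \<noteq> 0 \<Longrightarrow> u3 x t = of_real (3 * t / (pi * x) *
         (LBINT y:{0<..}. exp (- (x * y / 2)) * sin (sqrt 3 / 2 * x * y) * y\<^sup>2 * exp (- t * y ^ 3)))"
proof -
  note int = set_integrable_airy_kernel[OF assms, of 2 x]
  have "set_integrable lborel {0<..} (airy_kernel 2 x t)"
    by (rule set_integrable_subset[OF int]) auto
  then have int': "integrable lborel (\<lambda>y. Im (indicator {0<..} y *\<^sub>R airy_kernel 2 x t y))"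
    unfolding set_integrable_def by (rule integrable_Im)
  then show "set_integrable lborel {0<..}
         (\<lambda>y. exp (- (x * y / 2)) * sin (sqrt 3 / 2 * x * y) * y\<^sup>2 * exp (- t * y ^ 3))"
    by (simp add: set_integrable_def Im_airy_kernel)
  have "(LBINT y:{0<..}. Im (airy_kernel 2 x t y)) = (LBINT y:{0..}. Im (airy_kernel 2 x t y))"
    by (rule set_integral_discrete_difference[of "{0}"]) auto
  also have "\<dots> = Im (airy_moment 2 x t)"
    using integral_Im[OF int[unfolded set_integrable_def]]
    by (simp add: airy_moment_def set_lebesgue_integral_def)
  finally have Im: "(LBINT y:{0<..}. exp (- (x * y / 2)) * sin (sqrt 3 / 2 * x * y) * y\<^sup>2 * exp (- t * y ^ 3)) =
      Im (airy_moment 2 x t)"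
    by (simp only: Im_airy_kernel)
  have "x * Re (airy_root * airy_moment 0 x t) = 3 * t * Im (airy_moment 2 x t)"
    using arg_cong[OF airy_moment_recurrence[OF assms, of x], of Im] by (simp add: algebra_simps)
  then show "u3 x t = of_real (3 * t / (pi * x) *
         (LBINT y:{0<..}. exp (- (x * y / 2)) * sin (sqrt 3 / 2 * x * y) * y\<^sup>2 * exp (- t * y ^ 3)))"
    if "x \<noteq> 0"
    unfolding u3_eq_moment[OF assms] Im using that by (simp add: field_simps del: of_real_mult of_real_divide)
qed

section \<open>The differential equation\<close>

text \<open>Candidate for the \<open>n\<close>-th space derivative of \<open>u3\<close>: each
  derivative of a moment in \<open>x\<close> raises its order and brings out
  \<open>\<i> * airy_root\<close>.\<close>

definition u3_deriv :: "nat \<Rightarrow> real \<Rightarrow> real \<Rightarrow> complex" where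
  "u3_deriv n x t = of_real (Re (airy_root * (\<i> * airy_root) ^ n * airy_moment n x t) / pi)"

lemma u3_derivatives:
  assumes "t > 0"
  shows "u3 x t = u3_deriv 0 x t"
    and "((\<lambda>x. u3_deriv n x t) has_vector_derivative u3_deriv (Suc n) x t) (at x)"
    and "((\<lambda>t. u3 x t) has_vector_derivative - u3_deriv 3 x t) (at t)"
proof -
  have u3: "u3 x t = u3_deriv 0 x t" if "t > 0" for t
    using u3_eq_moment[OF that] by (simp add: u3_deriv_def)
  then show "u3 x t = u3_deriv 0 x t" using assms .
  \<comment> \<open>Taking real parts is linear only over the reals, which is enough because all
    derivatives are taken in a real variable.\<close>
  have lin: "bounded_linear (\<lambda>z. complex_of_real (Re (c * z) / pi))" for c
    by (intro bounded_linear_compose[OF bounded_linear_of_real] bounded_linear_divide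
        bounded_linear_compose[OF bounded_linear_Re] bounded_linear_mult_right
        bounded_linear_compose[OF bounded_linear_divide])
  show "((\<lambda>x. u3_deriv n x t) has_vector_derivative u3_deriv (Suc n) x t) (at x)"
    using bounded_linear.has_vector_derivative[OF lin airy_moment_deriv_x[OF assms],
        of "airy_root * (\<i> * airy_root) ^ n" n x]
    by (simp only: u3_deriv_def power_Suc2 mult.assoc)
  \<comment> \<open>Since \<open>(\<i> * airy_root) ^ 3\<close> equals 1, the third space derivative
    and the negative time derivative involve the same moment with the same factor: this is the
    equation itself.\<close>
  have "airy_root * (\<i> * airy_root) ^ 3 = airy_root"
    by (simp add: power_mult_distrib airy_root_cubed power3_eq_cube[of \<i>])
  then have "u3_deriv 3 x t = of_real (Re (airy_root * airy_moment 3 x t) / pi)"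
    by (simp only: u3_deriv_def)
  then have D3: "of_real (Re (airy_root * - airy_moment (0 + 3) x t) / pi) = - u3_deriv 3 x t"
    by (simp del: times_complex.sel)
  have D0: "u3_deriv 0 x t = of_real (Re (airy_root * airy_moment 0 x t) / pi)" for t
    by (simp add: u3_deriv_def)
  have "((\<lambda>t. u3_deriv 0 x t) has_vector_derivative - u3_deriv 3 x t) (at t)"
    using bounded_linear.has_vector_derivative[OF lin airy_moment_deriv_t[OF assms], of airy_root 0 x]
    by (simp only: D0 D3)
  \<comment> \<open>The moment formula for \<open>u3\<close> is available at positive times, so the
    derivative is transferred on the open half-line.\<close>
  then show "((\<lambda>t. u3 x t) has_vector_derivative - u3_deriv 3 x t) (at t)"
    by (rule has_vector_derivative_transform_within_open[where S = "{0<..}"]) (use assms u3 in auto)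
qed

lemma continuous_on_u3:
  assumes "t > 0" shows "continuous_on A (\<lambda>x. u3 x t)"
  using u3_derivatives(2)[OF assms, of 0] unfolding u3_derivatives(1)[OF assms, symmetric]
  by (intro continuous_at_imp_continuous_on ballI has_vector_derivative_continuous)

section \<open>The expectation over the generalized gamma variable\<close>

text \<open>With parameters 3 and \<open>1 / t\<close> the density is
  \<open>3 * t * y^2 * exp (- t * y ^ 3)\<close> on the positive axis, exactly the weight of the
  rotated integral; integrability and value both transfer along the distribution.\<close>

lemma
  fixes M :: "'a measure" and G :: "'a \<Rightarrow> real"
  assumes t: "t > 0"
    and G: "distributed M lborel G (\<lambda>y. ennreal (gen_gamma_density 3 (1 / t) y))"
  shows integrable_gen_gamma: "integrable M (\<lambda>\<omega>. exp (- (x / 2) * G \<omega>) * sin (sqrt 3 * x / 2 * G \<omega>))"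
    and expectation_gen_gamma: "(LINT \<omega>|M. exp (- (x / 2) * G \<omega>) * sin (sqrt 3 * x / 2 * G \<omega>)) =
      3 * t * (LBINT y:{0<..}. exp (- (x * y / 2)) * sin (sqrt 3 / 2 * x * y) * y\<^sup>2 * exp (- t * y ^ 3))"
proof -
  let ?g = "\<lambda>y. exp (- (x / 2) * y) * sin (sqrt 3 * x / 2 * y)"
  let ?h = "\<lambda>y. exp (- (x * y / 2)) * sin (sqrt 3 / 2 * x * y) * y\<^sup>2 * exp (- t * y ^ 3)"
  have eq: "(\<lambda>y. gen_gamma_density 3 (1 / t) y * ?g y) = (\<lambda>y. 3 * t * (indicator {0<..} y *\<^sub>R ?h y))"
    using t by (auto simp: fun_eq_iff gen_gamma_density_def indicator_def powr_numeral mult_ac)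
  have nonneg: "0 \<le> gen_gamma_density 3 (1 / t) y" for y
    using t by (simp add: gen_gamma_density_def)
  have meas: "?g \<in> borel_measurable lborel" by measurable
  have "integrable lborel (\<lambda>y. gen_gamma_density 3 (1 / t) y * ?g y)"
    unfolding eq using set_integrable_rotated[OF t, of x] unfolding set_integrable_def
    by (rule integrable_mult_right)
  then show "integrable M (\<lambda>\<omega>. exp (- (x / 2) * G \<omega>) * sin (sqrt 3 * x / 2 * G \<omega>))"
    using distributed_integrable[OF G meas nonneg] by simp
  have "(LINT \<omega>|M. ?g (G \<omega>)) = (\<integral>y. gen_gamma_density 3 (1 / t) y * ?g y \<partial>lborel)"
    using distributed_integral[OF G meas nonneg] by simp
  then show "(LINT \<omega>|M. exp (- (x / 2) * G \<omega>) * sin (sqrt 3 * x / 2 * G \<omega>)) =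
      3 * t * (LBINT y:{0<..}. ?h y)"
    unfolding eq set_lebesgue_integral_def by simp
qed

subsection \<open>The initial condition\<close>

text \<open>Extracts the data used below: two derivatives and a radius beyond which the function and
  its first derivative vanish.\<close>

lemma test_function_decompose:
  assumes "test_function \<phi>"
  obtains \<phi>' \<phi>'' L where "L > 0"
    "\<And>x. (\<phi> has_real_derivative \<phi>' x) (at x)" "\<And>x. (\<phi>' has_real_derivative \<phi>'' x) (at x)"
    "continuous_on UNIV \<phi>''" "\<And>x. \<bar>x\<bar> \<ge> L \<Longrightarrow> \<phi> x = 0" "\<And>x. \<bar>x\<bar> \<ge> L \<Longrightarrow> \<phi>' x = 0"
proof -
  have diff: "(deriv ^^ k) \<phi> differentiable at x" for k x
    using assms by (simp add: test_function_def)
  have "bounded {x. \<phi> x \<noteq> 0}"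
    using assms bounded_subset[OF compact_imp_bounded closure_subset] by (auto simp: test_function_def)
  then obtain B where B: "\<And>x. \<phi> x \<noteq> 0 \<Longrightarrow> \<bar>x\<bar> \<le> B" by (auto simp: bounded_iff)
  \<comment> \<open>The strict inequality describes an open set on which \<open>\<phi>\<close> is
    identically 0, so its derivative vanishes there too. The radius \<open>\<bar>B\<bar> + 1\<close>
    is positive and its exterior lies in this set.\<close>
  have zero: "(\<phi> has_real_derivative 0) (at x)" if "\<bar>x\<bar> > \<bar>B\<bar>" for x
  proof (rule has_field_derivative_transform_within_open[where f = "\<lambda>_. 0"])
    show "open {x :: real. \<bar>x\<bar> > \<bar>B\<bar>}" by (intro open_Collect_less continuous_intros)
    show "0 = \<phi> x" if "x \<in> {x. \<bar>x\<bar> > \<bar>B\<bar>}" for x using B[of x] that by force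
  qed (use that in auto)
  show ?thesis
  proof
    show "\<bar>B\<bar> + 1 > 0" by simp
    show "(\<phi> has_real_derivative deriv \<phi> x) (at x)" for x
      using diff[of 0 x] by (simp add: DERIV_deriv_iff_real_differentiable)
    show "(deriv \<phi> has_real_derivative deriv (deriv \<phi>) x) (at x)" for x
      using diff[of 1 x] by (simp add: DERIV_deriv_iff_real_differentiable)
    show "continuous_on UNIV (deriv (deriv \<phi>))"
      using diff[of 2] by (auto simp: numeral_2_eq_2 intro!: continuous_at_imp_continuous_on differentiable_imp_continuous_within)
    show "\<phi> x = 0" if "\<bar>x\<bar> \<ge> \<bar>B\<bar> + 1" for x using B[of x] that by force
    show "deriv \<phi> x = 0" if "\<bar>x\<bar> \<ge> \<bar>B\<bar> + 1" for x using zero[of x] that by (intro DERIV_imp_deriv) auto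
  qed
qed

text \<open>Supplies the majorant for letting \<open>R\<close> grow under an integral over the
  support of a test function. The rotated integral is bounded uniformly in \<open>x\<close>, and so
  is the error of the rotation.\<close>

lemma airy_phase_integral_bounded:
  assumes "t > 0"
  shows "\<exists>K. \<forall>\<^sub>F R in at_top. \<forall>x. \<bar>x\<bar> \<le> L \<longrightarrow> norm (integral {0..R} (\<lambda>\<beta>. airy_phase x t (of_real \<beta>))) \<le> K"
proof -
  obtain C where C: "\<And>x y. \<bar>x\<bar> \<le> L \<Longrightarrow> y \<ge> 0 \<Longrightarrow> norm (airy_kernel 0 x t y) \<le> C * exp (- y)"
    using airy_kernel_bound[OF assms, of L 0] by auto
  have "filterlim (\<lambda>R. 8 / 3 * t * R\<^sup>2 - L) at_top at_top" using assms by real_asymp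
  \<comment> \<open>Past this threshold the error \<open>1 / k\<close> is at most 1 for all
    \<open>\<bar>x\<bar> \<le> L\<close> simultaneously.\<close>
  then have ev: "\<forall>\<^sub>F R in at_top. 1 \<le> 8 / 3 * t * R\<^sup>2 - L" by (simp add: filterlim_at_top)
  have "norm (integral {0..R} (\<lambda>\<beta>. airy_phase x t (of_real \<beta>))) \<le> 1 + norm airy_root * \<bar>C\<bar>"
    if R: "1 \<le> 8 / 3 * t * R\<^sup>2 - L \<and> R > 0" and x: "\<bar>x\<bar> \<le> L" for R x
  proof -
    let ?S = "2 * R / sqrt 3"
    let ?k = "8 / 3 * t * R\<^sup>2 - \<bar>x\<bar>"
    have "norm (integral {0..R} (\<lambda>\<beta>. airy_phase x t (of_real \<beta>)) - airy_root * integral {0..?S} (airy_kernel 0 x t)) \<le> 1 / ?k"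
      using R x by (intro airy_phase_truncation_error assms) auto
    also have "\<dots> \<le> 1" using R x by simp
    finally have 1: "norm (integral {0..R} (\<lambda>\<beta>. airy_phase x t (of_real \<beta>)) - airy_root * integral {0..?S} (airy_kernel 0 x t)) \<le> 1" .
    have E: "((\<lambda>y. \<bar>C\<bar> * exp (- y)) has_integral \<bar>C\<bar> * (- exp (- ?S) - (- exp (- 0)))) {0..?S}"
      using R by (intro has_integral_mult_right fundamental_theorem_of_calculus)
        (auto intro!: derivative_eq_intros simp flip: has_real_derivative_iff_has_vector_derivative)
    have "norm (integral {0..?S} (airy_kernel 0 x t)) \<le> integral {0..?S} (\<lambda>y. \<bar>C\<bar> * exp (- y))"
    proof (rule integral_norm_bound_integral)
      show "norm (airy_kernel 0 x t y) \<le> \<bar>C\<bar> * exp (- y)" if "y \<in> {0..?S}" for y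
        using C[OF x, of y] that by (auto intro: order_trans mult_right_mono)
    qed (auto intro!: integrable_continuous_interval continuous_on_airy_kernel continuous_intros)
    also have "\<dots> \<le> \<bar>C\<bar> * 1"
      unfolding integral_unique[OF E] by (intro mult_left_mono) auto
    finally have "norm (airy_root * integral {0..?S} (airy_kernel 0 x t)) \<le> norm airy_root * \<bar>C\<bar>"
      by (simp add: norm_mult mult_left_mono)
    then show ?thesis using 1 norm_triangle_sub by (smt (verit))
  qed
  then show ?thesis
    by (intro exI[of _ "1 + norm airy_root * \<bar>C\<bar>"] eventually_mono[OF eventually_conj[OF ev eventually_gt_at_top[of 0]]]) blast
qed

section \<open>The sine integral and the Dirichlet kernel\<close>

lemma Si_0: "Si 0 = 0"
  using Si_neg[of 0] by simp

text \<open>The negative side follows from the oddness of \<open>Si\<close>, and at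
  \<open>x = 0\<close> both sides are 0.\<close>

lemma Si_scaled_tendsto: "(\<lambda>n. Si (real n * x)) \<longlonglongrightarrow> sgn x * (pi / 2)"
proof -
  have pos: "(\<lambda>n. Si (real n * x)) \<longlonglongrightarrow> pi / 2" if "x > 0" for x
    using that by (intro filterlim_compose[OF Si_at_top]) real_asymp
  consider "x > 0" | "x = 0" | "x < 0" by linarith
  then show ?thesis
  proof cases
    case 3
    then have "Si (real n * x) = - Si (real n * - x)" for n
      using Si_neg[of "real n * - x"] by (simp add: mult_nonneg_nonpos)
    then show ?thesis using tendsto_minus[OF pos[of "- x"]] 3 by simp
  qed (use pos in \<open>auto simp: Si_0\<close>)
qed

text \<open>This is the Dirichlet kernel \<open>sin (R * x) / x\<close>; writing it with
  \<open>sinc\<close> includes \<open>x = 0\<close> and exhibits it as the derivative of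
  \<open>Si (R * x)\<close> in \<open>x\<close>.\<close>

lemma Re_airy_phase_0_integral:
  assumes "R \<ge> 0"
  shows "Re (integral {0..R} (\<lambda>\<beta>. airy_phase x 0 (of_real \<beta>))) = R * sinc (R * x)"
proof -
  have int: "(\<lambda>\<beta>. airy_phase x 0 (of_real \<beta>)) integrable_on {0..R}"
    unfolding airy_phase_real by (intro integrable_continuous_interval continuous_intros)
  have "((\<lambda>\<beta>. cos (x * \<beta>)) has_integral R * sinc (R * x)) {0..R}"
  proof (cases "x = 0")
    case True
    then show ?thesis using has_integral_const_real[of "1 :: real" 0 R] assms by simp
  next
    case False
    have "((\<lambda>\<beta>. cos (x * \<beta>)) has_integral (sin (x * R) / x - sin (x * 0) / x)) {0..R}"
      using assms False
      by (intro fundamental_theorem_of_calculus)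
        (auto intro!: derivative_eq_intros simp flip: has_real_derivative_iff_has_vector_derivative)
    also have "sin (x * R) / x - sin (x * 0) / x = R * sinc (R * x)"
      using False by (auto simp: mult.commute)
    finally show ?thesis .
  qed
  moreover have "((\<lambda>\<beta>. cos (x * \<beta>)) has_integral
      Re (integral {0..R} (\<lambda>\<beta>. airy_phase x 0 (of_real \<beta>)))) {0..R}"
    using has_integral_Re[OF integrable_integral[OF int]] by (simp add: airy_phase_real)
  ultimately show ?thesis by (rule has_integral_unique[rotated])
qed

section \<open>Pairing with a fixed test function\<close>

context
  fixes \<phi> \<phi>' \<phi>'' :: "real \<Rightarrow> real" and L :: real
  assumes L: "L > 0"
    and deriv: "\<And>x. (\<phi> has_real_derivative \<phi>' x) (at x)"
    and deriv': "\<And>x. (\<phi>' has_real_derivative \<phi>'' x) (at x)"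
    and cont'': "continuous_on UNIV \<phi>''"
    and supp: "\<And>x. \<bar>x\<bar> \<ge> L \<Longrightarrow> \<phi> x = 0" "\<And>x. \<bar>x\<bar> \<ge> L \<Longrightarrow> \<phi>' x = 0"
begin

lemma cont_phi: "continuous_on A \<phi>" "continuous_on A \<phi>'" "continuous_on A \<phi>''"
  using deriv deriv' cont''
  by (auto intro: continuous_at_imp_continuous_on DERIV_isCont continuous_on_subset)

text \<open>The Fourier integral of \<open>\<phi>\<close> with the time multiplier of the equation;
  \<open>{- L..L}\<close> contains the support.\<close>

definition osc_transform :: "real \<Rightarrow> real \<Rightarrow> complex" where
  "osc_transform t \<beta> = integral {- L..L} (\<lambda>x. \<phi> x *\<^sub>R airy_phase x t (of_real \<beta>))"

lemma continuous_osc_integrand: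
  "continuous_on S (\<lambda>(x, \<beta>). \<phi> x *\<^sub>R airy_phase x t (of_real \<beta>))"
  unfolding case_prod_beta airy_phase_real
  by (intro continuous_intros continuous_on_compose2[OF cont_phi(1)[of UNIV]]) auto

text \<open>Time enters only through a factor of modulus 1 that does not depend on \<open>x\<close>.
  Bounds at time 0 therefore hold at all times.\<close>

lemma osc_transform_eq: "osc_transform t \<beta> = cis (t * \<beta> ^ 3) * osc_transform 0 \<beta>"
  unfolding osc_transform_def airy_phase_real
  by (simp add: cis_mult[symmetric] mult.commute[of "cis (t * \<beta> ^ 3)"] flip: integral_mult_left mult_scaleR_left)

lemma continuous_osc_transform: "continuous_on A (osc_transform t)"
proof -
  have "continuous_on A (\<lambda>\<beta>. integral (cbox (- L) L) (\<lambda>x. \<phi> x *\<^sub>R airy_phase x t (of_real \<beta>)))"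
    unfolding airy_phase_real case_prod_beta
    by (intro integral_continuous_on_param, unfold case_prod_beta)
       (intro continuous_intros continuous_on_compose2[OF cont_phi(1)[of UNIV]]; auto)
  then show ?thesis by (simp add: osc_transform_def[abs_def])
qed

text \<open>The boundary terms vanish at both ends, so \<open>1 + \<beta>^2\<close> times the
  transform of \<open>\<phi>\<close> is the transform of \<open>\<phi> - \<phi>''\<close>, which is
  bounded. The resulting majorant is integrable and independent of \<open>t\<close>, hence survives
  the limit at time 0.\<close>

lemma osc_transform_bound: "\<exists>C. \<forall>t \<beta>. norm (osc_transform t \<beta>) \<le> C * inverse (1 + \<beta>\<^sup>2)"
proof -
  let ?C = "integral {- L..L} (\<lambda>x. \<bar>\<phi> x - \<phi>'' x\<bar>)"
  have "norm (osc_transform 0 \<beta>) \<le> ?C * inverse (1 + \<beta>\<^sup>2)" for \<beta>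
  proof -
    \<comment> \<open>the boundary term of two integrations by parts, arranged so that no division by \<open>\<beta>\<close> occurs\<close>
    let ?H = "\<lambda>x. (of_real (\<phi>' x) - \<i> * of_real \<beta> * of_real (\<phi> x)) * cis (x * \<beta>)"
    have int: "(\<lambda>x. \<phi> x *\<^sub>R cis (x * \<beta>)) integrable_on {- L..L}" "(\<lambda>x. \<phi>'' x *\<^sub>R cis (x * \<beta>)) integrable_on {- L..L}"
      "(\<lambda>x. (\<phi> x - \<phi>'' x) *\<^sub>R cis (x * \<beta>)) integrable_on {- L..L}"
      by (intro integrable_continuous_interval continuous_intros cont_phi)+
    have d: "((\<lambda>x. of_real (f x) :: complex) has_vector_derivative of_real (f' x)) (at x within A)"
      if "\<And>x. (f has_real_derivative f' x) (at x)" for f f' x A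
      by (rule has_vector_derivative_of_real) (rule has_field_derivative_at_within[OF that])
    have dc: "((\<lambda>x. cis (x * \<beta>)) has_vector_derivative \<i> * of_real \<beta> * cis (x * \<beta>)) (at x within A)" for x A
      unfolding cis_conv_exp of_real_mult
      by (rule has_vector_derivative_real_field[where f = "\<lambda>x. exp (\<i> * (x * of_real \<beta>))"])
         (auto intro!: derivative_eq_intros)
    have "(?H has_vector_derivative (of_real (\<phi>'' x) - \<i> * of_real \<beta> * of_real (\<phi>' x)) * cis (x * \<beta>) +
        (of_real (\<phi>' x) - \<i> * of_real \<beta> * of_real (\<phi> x)) * (\<i> * of_real \<beta> * cis (x * \<beta>))) (at x within A)" for x A
      by (rule has_vector_derivative_eq_rhs,
          rule has_vector_derivative_mult[OF has_vector_derivative_diff[OF d[OF deriv'] has_vector_derivative_mult_right[OF d[OF deriv]]] dc])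
         (simp add: algebra_simps)
    also have "(\<lambda>x. (of_real (\<phi>'' x) - \<i> * of_real \<beta> * of_real (\<phi>' x)) * cis (x * \<beta>) +
        (of_real (\<phi>' x) - \<i> * of_real \<beta> * of_real (\<phi> x)) * (\<i> * of_real \<beta> * cis (x * \<beta>)))
        = (\<lambda>x. \<phi>'' x *\<^sub>R cis (x * \<beta>) + \<beta>\<^sup>2 *\<^sub>R (\<phi> x *\<^sub>R cis (x * \<beta>)))"
      by (simp add: fun_eq_iff scaleR_conv_of_real algebra_simps power2_eq_square)
    finally have H: "(?H has_vector_derivative \<phi>'' x *\<^sub>R cis (x * \<beta>) + \<beta>\<^sup>2 *\<^sub>R (\<phi> x *\<^sub>R cis (x * \<beta>))) (at x within A)" for x A .
    have h1: "((\<lambda>x. \<phi>'' x *\<^sub>R cis (x * \<beta>) + \<beta>\<^sup>2 *\<^sub>R (\<phi> x *\<^sub>R cis (x * \<beta>))) has_integral (?H L - ?H (- L))) {- L..L}"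
      using L by (intro fundamental_theorem_of_calculus H) auto
    have h2: "((\<lambda>x. \<phi>'' x *\<^sub>R cis (x * \<beta>) + \<beta>\<^sup>2 *\<^sub>R (\<phi> x *\<^sub>R cis (x * \<beta>))) has_integral
       (integral {- L..L} (\<lambda>x. \<phi>'' x *\<^sub>R cis (x * \<beta>)) + \<beta>\<^sup>2 *\<^sub>R integral {- L..L} (\<lambda>x. \<phi> x *\<^sub>R cis (x * \<beta>)))) {- L..L}"
      by (intro has_integral_add has_integral_cmul integrable_integral int)
    have "?H L - ?H (- L) = 0" using L by (simp add: supp)
    with has_integral_unique[OF h2 h1] have "integral {- L..L} (\<lambda>x. \<phi>'' x *\<^sub>R cis (x * \<beta>)) + \<beta>\<^sup>2 *\<^sub>R integral {- L..L} (\<lambda>x. \<phi> x *\<^sub>R cis (x * \<beta>)) = 0"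
      by (rule trans)
    then have "(1 + \<beta>\<^sup>2) *\<^sub>R integral {- L..L} (\<lambda>x. \<phi> x *\<^sub>R cis (x * \<beta>)) =
        integral {- L..L} (\<lambda>x. \<phi> x *\<^sub>R cis (x * \<beta>)) - integral {- L..L} (\<lambda>x. \<phi>'' x *\<^sub>R cis (x * \<beta>))"
      by (simp add: scaleR_add_left eq_neg_iff_add_eq_0 add.commute)
    also have "\<dots> = integral {- L..L} (\<lambda>x. (\<phi> x - \<phi>'' x) *\<^sub>R cis (x * \<beta>))"
      by (simp add: scaleR_diff_left Henstock_Kurzweil_Integration.integral_diff[OF int(1,2)])
    finally have eq: "(1 + \<beta>\<^sup>2) *\<^sub>R integral {- L..L} (\<lambda>x. \<phi> x *\<^sub>R cis (x * \<beta>)) =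
        integral {- L..L} (\<lambda>x. (\<phi> x - \<phi>'' x) *\<^sub>R cis (x * \<beta>))" .
    have "(1 + \<beta>\<^sup>2) * norm (osc_transform 0 \<beta>) = norm (integral {- L..L} (\<lambda>x. (\<phi> x - \<phi>'' x) *\<^sub>R cis (x * \<beta>)))"
      unfolding eq[symmetric] by (simp add: osc_transform_def airy_phase_real)
    also have "\<dots> \<le> ?C"
      by (intro Henstock_Kurzweil_Integration.integral_norm_bound_integral int)
         (auto intro!: integrable_continuous_interval continuous_intros cont_phi)
    finally show ?thesis
      by (simp add: field_simps add_pos_nonneg)
  qed
  moreover have "norm (osc_transform t \<beta>) = norm (osc_transform 0 \<beta>)" for t \<beta>
    by (subst osc_transform_eq) (simp add: norm_mult)
  ultimately have "norm (osc_transform t \<beta>) \<le> ?C * inverse (1 + \<beta>\<^sup>2)" for t \<beta> by metis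
  then show ?thesis by blast
qed

text \<open>The order of integration is exchanged on a compact rectangle, before \<open>R\<close>
  grows; on the full half-line the double integral is not absolutely convergent.\<close>

lemma integral_osc_transform:
  "integral {- L..L} (\<lambda>x. \<phi> x *\<^sub>R integral {0..R} (\<lambda>\<beta>. airy_phase x t (of_real \<beta>))) =
   integral {0..R} (osc_transform t)"
  using integral_swap_continuous[of "- L" 0 L R "\<lambda>x \<beta>. \<phi> x *\<^sub>R airy_phase x t (of_real \<beta>)",
      OF continuous_osc_integrand]
  by (simp add: osc_transform_def[abs_def])

lemma set_integrable_osc_dominator: "set_integrable lborel {0..} (\<lambda>\<beta>::real. C * inverse (1 + \<beta>\<^sup>2))"
proof -
  have "set_integrable lborel UNIV (\<lambda>\<beta>::real. inverse (1 + \<beta>\<^sup>2))"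
    using integrable_inverse_1_plus_square by simp
  then have "set_integrable lborel {0..} (\<lambda>\<beta>::real. inverse (1 + \<beta>\<^sup>2))"
    by (rule set_integrable_subset) auto
  then show ?thesis by simp
qed

lemma osc_transform_measurable: "(\<lambda>\<beta>. indicator {0..} \<beta> *\<^sub>R osc_transform t \<beta>) \<in> borel_measurable lborel"
  using borel_measurable_continuous_on_indicator[OF _ continuous_osc_transform, of "{0..}"] by simp

lemma set_integrable_osc_transform: "set_integrable lborel {0..} (osc_transform t)"
proof -
  obtain C where C: "\<And>t \<beta>. norm (osc_transform t \<beta>) \<le> C * inverse (1 + \<beta>\<^sup>2)"
    using osc_transform_bound by blast
  show ?thesis
    unfolding set_integrable_def
  proof (rule Bochner_Integration.integrable_bound[OF set_integrable_osc_dominator[of C, unfolded set_integrable_def] osc_transform_measurable])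
    show "AE \<beta> in lborel. norm (indicator {0..} \<beta> *\<^sub>R osc_transform t \<beta>) \<le> norm (indicator {0..} \<beta> *\<^sub>R (C * inverse (1 + \<beta>\<^sup>2)))"
      using C by (auto split: split_indicator intro!: order_trans[OF C abs_ge_self])
  qed
qed

lemma osc_transform_integral_tendsto:
  "((\<lambda>R. integral {0..R} (osc_transform t)) \<longlongrightarrow> (LBINT \<beta>:{0..}. osc_transform t \<beta>)) at_top"
proof -
  have "(LBINT \<beta>:{0..R}. osc_transform t \<beta>) = integral {0..R} (osc_transform t)" for R
    by (rule set_borel_integral_eq_integral)
       (rule set_integrable_subset[OF set_integrable_osc_transform], auto)
  then show ?thesis
    using tendsto_set_lebesgue_integral_at_top[of 0 lborel, OF _ set_integrable_osc_transform[of t]]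
    by simp
qed

text \<open>Dominated convergence: the multiplier tends to 1 at each frequency and the majorant does
  not depend on \<open>t\<close>.\<close>

lemma osc_transform_integral_at_right:
  "((\<lambda>t. LBINT \<beta>:{0..}. osc_transform t \<beta>) \<longlongrightarrow> (LBINT \<beta>:{0..}. osc_transform 0 \<beta>)) (at_right 0)"
proof -
  obtain C where C: "\<And>t \<beta>. norm (osc_transform t \<beta>) \<le> C * inverse (1 + \<beta>\<^sup>2)"
    using osc_transform_bound by blast
  show ?thesis
    unfolding tendsto_at_iff_sequentially comp_def
  proof (intro allI impI)
    fix X :: "nat \<Rightarrow> real" assume X: "X \<longlonglongrightarrow> 0"
    show "(\<lambda>n. LBINT \<beta>:{0..}. osc_transform (X n) \<beta>) \<longlonglongrightarrow> (LBINT \<beta>:{0..}. osc_transform 0 \<beta>)"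
      unfolding set_lebesgue_integral_def
    proof (rule integral_dominated_convergence[OF osc_transform_measurable osc_transform_measurable
          set_integrable_osc_dominator[of C, unfolded set_integrable_def]])
      show "AE \<beta> in lborel. (\<lambda>n. indicator {0..} \<beta> *\<^sub>R osc_transform (X n) \<beta>) \<longlonglongrightarrow> indicator {0..} \<beta> *\<^sub>R osc_transform 0 \<beta>"
      proof (rule AE_I2)
        fix \<beta> :: real
        have "(\<lambda>n. cis (X n * \<beta> ^ 3) * osc_transform 0 \<beta>) \<longlonglongrightarrow> cis (0 * \<beta> ^ 3) * osc_transform 0 \<beta>"
          by (intro tendsto_intros X)
        then have "(\<lambda>n. osc_transform (X n) \<beta>) \<longlonglongrightarrow> osc_transform 0 \<beta>"
          by (simp flip: osc_transform_eq)
        then show "(\<lambda>n. indicator {0..} \<beta> *\<^sub>R osc_transform (X n) \<beta>) \<longlonglongrightarrow> indicator {0..} \<beta> *\<^sub>R osc_transform 0 \<beta>"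
          by (intro tendsto_scaleR tendsto_const)
      qed
      show "AE \<beta> in lborel. norm (indicator {0..} \<beta> *\<^sub>R osc_transform (X n) \<beta>) \<le> indicator {0..} \<beta> *\<^sub>R (C * inverse (1 + \<beta>\<^sup>2))" for n
        using C by (auto split: split_indicator)
    qed
  qed
qed

text \<open>Fourier inversion at the origin. Truncation gives the Dirichlet kernel paired with
  \<open>\<phi>\<close>; an integration by parts replaces the kernel by its primitive
  \<open>Si\<close>, which tends boundedly to a multiple of the sign function.\<close>

lemma osc_transform_0_integral: "Re (LBINT \<beta>:{0..}. osc_transform 0 \<beta>) = pi * \<phi> 0"
proof -
  obtain B where B: "\<And>T. \<bar>Si T\<bar> \<le> B" using bounded_Si by blast
  have int: "(\<lambda>x. \<phi>' x * Si (R * x)) integrable_on {- L..L}" for R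
    by (intro integrable_continuous_interval continuous_intros cont_phi
        continuous_on_compose2[OF continuous_at_imp_continuous_on[of UNIV Si]]) (auto intro: isCont_Si)
  \<comment> \<open>The boundary terms vanish with \<open>\<phi>\<close> at both ends. Unlike the
    kernel, \<open>Si (real n * x)\<close> is bounded uniformly in \<open>n\<close>, so the limit
    can be taken afterwards.\<close>
  have "Re (integral {0..real n} (osc_transform 0)) = - integral {- L..L} (\<lambda>x. \<phi>' x * Si (real n * x))" for n
  proof -
    let ?A = "\<lambda>x. integral {0..real n} (\<lambda>\<beta>. airy_phase x 0 (of_real \<beta>))"
    have "continuous_on {- L..L} ?A"
      using integral_continuous_on_param[of "{- L..L}" 0 "real n" "\<lambda>x \<beta>. airy_phase x 0 (of_real \<beta>)"]
      by (simp add: airy_phase_real case_prod_beta continuous_intros)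
    then have "((\<lambda>x. \<phi> x *\<^sub>R ?A x) has_integral integral {- L..L} (\<lambda>x. \<phi> x *\<^sub>R ?A x)) {- L..L}"
      by (intro integrable_integral integrable_continuous_interval continuous_intros cont_phi)
    then have "((\<lambda>x. Re (\<phi> x *\<^sub>R ?A x)) has_integral Re (integral {- L..L} (\<lambda>x. \<phi> x *\<^sub>R ?A x))) {- L..L}"
      by (rule has_integral_Re)
    then have 1: "((\<lambda>x. \<phi> x * (real n * sinc (real n * x))) has_integral Re (integral {0..real n} (osc_transform 0))) {- L..L}"
      unfolding integral_osc_transform by (simp only: scaleR_complex.sel Re_airy_phase_0_integral of_nat_0_le_iff)
    have "((\<lambda>x. \<phi> x * Si (real n * x)) has_real_derivative
        (\<phi>' x * Si (real n * x) + \<phi> x * (real n * sinc (real n * x)))) (at x within S)" for x S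
      by (rule derivative_eq_intros DERIV_chain2[OF DERIV_Si] has_field_derivative_at_within[OF deriv] refl | simp add: mult_ac)+
    then have "((\<lambda>x. \<phi>' x * Si (real n * x) + \<phi> x * (real n * sinc (real n * x))) has_integral
        (\<phi> L * Si (real n * L) - \<phi> (- L) * Si (real n * - L))) {- L..L}"
      using L by (intro fundamental_theorem_of_calculus)
        (auto simp only: has_real_derivative_iff_has_vector_derivative[symmetric])
    then have 2: "((\<lambda>x. \<phi>' x * Si (real n * x) + \<phi> x * (real n * sinc (real n * x))) has_integral 0) {- L..L}"
      using L by (simp add: supp)
    have "((\<lambda>x. \<phi> x * (real n * sinc (real n * x))) has_integral (0 - integral {- L..L} (\<lambda>x. \<phi>' x * Si (real n * x)))) {- L..L}"
      using has_integral_diff[OF 2 integrable_integral[OF int[of "real n"]]] by simp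
    from has_integral_unique[OF 1 this] show ?thesis by simp
  qed
  moreover have "(\<lambda>n. integral {- L..L} (\<lambda>x. \<phi>' x * Si (real n * x))) \<longlonglongrightarrow> integral {- L..L} (\<lambda>x. \<phi>' x * (sgn x * (pi / 2)))"
  proof (rule dominated_convergence(2)[where h = "\<lambda>x. \<bar>\<phi>' x\<bar> * B"])
    show "(\<lambda>n. \<phi>' x * Si (real n * x)) \<longlonglongrightarrow> \<phi>' x * (sgn x * (pi / 2))" for x
      by (intro tendsto_mult tendsto_const Si_scaled_tendsto)
    show "(\<lambda>x. \<bar>\<phi>' x\<bar> * B) integrable_on {- L..L}"
      by (intro integrable_continuous_interval continuous_intros cont_phi)
    show "norm (\<phi>' x * Si (real n * x)) \<le> \<bar>\<phi>' x\<bar> * B" for x n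
      using B by (simp add: abs_mult mult_left_mono)
  qed (rule int)
  moreover have "integral {- L..L} (\<lambda>x. \<phi>' x * (sgn x * (pi / 2))) = - (pi * \<phi> 0)"
  proof -
    have ftc: "(\<phi>' has_integral (\<phi> b - \<phi> a)) {a..b}" if "a \<le> b" for a b
      using that deriv
      by (intro fundamental_theorem_of_calculus)
        (auto simp flip: has_real_derivative_iff_has_vector_derivative intro: has_field_derivative_at_within)
    \<comment> \<open>On either side of 0 the sign is constant, and its value at 0 is a single
      point; each half reduces to the fundamental theorem, and each contributes
      \<open>- (pi / 2) * \<phi> 0\<close>.\<close>
    have half: "((\<lambda>x. \<phi>' x * (sgn x * (pi / 2))) has_integral (\<phi> b - \<phi> a) * c) {a..b}"
      if "a \<le> b" "\<And>x. x \<in> {a..b} - {0} \<Longrightarrow> sgn x * (pi / 2) = c" for a b c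
      by (rule has_integral_spike_finite[of "{0}", OF _ _ has_integral_mult_left[OF ftc[OF that(1)]]])
         (simp, metis that(2))
    have l: "((\<lambda>x. \<phi>' x * (sgn x * (pi / 2))) has_integral ((\<phi> 0 - \<phi> (- L)) * (- (pi / 2)))) {- L..0}"
      by (rule half) (use L in \<open>auto simp: sgn_if\<close>)
    have r: "((\<lambda>x. \<phi>' x * (sgn x * (pi / 2))) has_integral ((\<phi> L - \<phi> 0) * (pi / 2))) {0..L}"
      by (rule half) (use L in \<open>auto simp: sgn_if\<close>)
    have "((\<lambda>x. \<phi>' x * (sgn x * (pi / 2))) has_integral
        (\<phi> 0 - \<phi> (- L)) * (- (pi / 2)) + (\<phi> L - \<phi> 0) * (pi / 2)) {- L..L}"
      by (rule has_integral_combine[OF _ _ l r]) (use L in auto)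
    from integral_unique[OF this] show ?thesis using L by (simp only: supp) (simp add: supp)
  qed
  ultimately have "(\<lambda>n. Re (integral {0..real n} (osc_transform 0))) \<longlonglongrightarrow> - (- (pi * \<phi> 0))"
    by (simp only: tendsto_minus)
  then have "(\<lambda>n. Re (integral {0..real n} (osc_transform 0))) \<longlonglongrightarrow> pi * \<phi> 0" by simp
  moreover have "(\<lambda>n. Re (integral {0..real n} (osc_transform 0))) \<longlonglongrightarrow> Re (LBINT \<beta>:{0..}. osc_transform 0 \<beta>)"
    by (intro tendsto_Re filterlim_compose[OF osc_transform_integral_tendsto] filterlim_real_sequentially)
  ultimately show ?thesis by (rule LIMSEQ_unique[symmetric])
qed

text \<open>Both sides are limits of the same truncated double integral: in \<open>x\<close> by
  dominated convergence with the uniform bound \<open>K\<close>, in \<beta> by integrability of the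
  transform. As \<open>\<phi>\<close> is real, taking real parts commutes with the pairing.\<close>

lemma pairing_u3:
  assumes "t > 0"
  shows "(LINT x|lborel. \<phi> x *\<^sub>R u3 x t) = of_real (Re (LBINT \<beta>:{0..}. osc_transform t \<beta>) / pi)"
proof -
  let ?A = "\<lambda>n x. integral {0..n} (\<lambda>\<beta>. airy_phase x t (of_real \<beta>))"
  let ?W = "\<lambda>x. airy_root * airy_moment 0 x t"
  obtain K where "\<forall>\<^sub>F R in at_top. \<forall>x. \<bar>x\<bar> \<le> L \<longrightarrow> norm (?A R x) \<le> K"
    using airy_phase_integral_bounded[OF assms, of L] by blast
  then obtain N where K: "\<And>R x. R \<ge> N \<Longrightarrow> \<bar>x\<bar> \<le> L \<Longrightarrow> norm (?A R x) \<le> K"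
    unfolding eventually_at_top_linorder by blast
  \<comment> \<open>Starting the truncations at \<open>N\<close> makes the bound \<open>K\<close>
    valid for every index.\<close>
  have lim_top: "filterlim (\<lambda>n. N + real n) at_top sequentially"
    by (intro filterlim_tendsto_add_at_top[OF tendsto_const] filterlim_real_sequentially)
  have dc: "(\<lambda>x. \<phi> x *\<^sub>R ?W x) integrable_on {- L..L} \<and>
     (\<lambda>n. integral {- L..L} (\<lambda>x. \<phi> x *\<^sub>R ?A (N + real n) x)) \<longlonglongrightarrow> integral {- L..L} (\<lambda>x. \<phi> x *\<^sub>R ?W x)"
  proof -
    have "continuous_on {- L..L} (?A R)" for R
      using integral_continuous_on_param[of "{- L..L}" 0 R "\<lambda>x \<beta>. airy_phase x t (of_real \<beta>)"]
      by (simp add: airy_phase_real case_prod_beta continuous_intros)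
    then have f: "(\<lambda>x. \<phi> x *\<^sub>R ?A (N + real n) x) integrable_on {- L..L}" for n
      by (intro integrable_continuous_interval continuous_intros cont_phi)
    have h: "(\<lambda>x. \<bar>\<phi> x\<bar> * K) integrable_on {- L..L}"
      by (intro integrable_continuous_interval continuous_intros cont_phi)
    have le: "norm (\<phi> x *\<^sub>R ?A (N + real n) x) \<le> \<bar>\<phi> x\<bar> * K" if "x \<in> {- L..L}" for n x
      using K[of "N + real n" x] that by (auto intro!: mult_left_mono)
    have conv: "(\<lambda>n. \<phi> x *\<^sub>R ?A (N + real n) x) \<longlonglongrightarrow> \<phi> x *\<^sub>R ?W x" for x
      by (intro tendsto_scaleR tendsto_const filterlim_compose[OF airy_phase_integral_tendsto[OF assms] lim_top])
    show ?thesis using dominated_convergence[OF f h le conv] by simp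
  qed
  have "(\<lambda>n. integral {- L..L} (\<lambda>x. \<phi> x *\<^sub>R ?A (N + real n) x)) \<longlonglongrightarrow> (LBINT \<beta>:{0..}. osc_transform t \<beta>)"
    unfolding integral_osc_transform
    by (rule filterlim_compose[OF osc_transform_integral_tendsto lim_top])
  then have eq: "integral {- L..L} (\<lambda>x. \<phi> x *\<^sub>R ?W x) = (LBINT \<beta>:{0..}. osc_transform t \<beta>)"
    by (rule LIMSEQ_unique[OF conjunct2[OF dc]])
  have "((\<lambda>x. complex_of_real (Re (\<phi> x *\<^sub>R ?W x) / pi)) has_integral
      of_real (Re (integral {- L..L} (\<lambda>x. \<phi> x *\<^sub>R ?W x)) / pi)) {- L..L}"
    by (intro has_integral_of_real has_integral_divide has_integral_Re integrable_integral conjunct1[OF dc])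
  also have "(\<lambda>x. complex_of_real (Re (\<phi> x *\<^sub>R ?W x) / pi)) = (\<lambda>x. \<phi> x *\<^sub>R u3 x t)"
    unfolding u3_eq_moment[OF assms] scaleR_complex.sel
    by (simp add: scaleR_conv_of_real fun_eq_iff del: times_complex.sel)
  finally have hk: "((\<lambda>x. \<phi> x *\<^sub>R u3 x t) has_integral of_real (Re (LBINT \<beta>:{0..}. osc_transform t \<beta>) / pi)) {- L..L}"
    unfolding eq .
  \<comment> \<open>Outside \<open>{- L..L}\<close> the test function vanishes, so the integral over
    the line is one of a continuous function over a compact interval.\<close>
  have "(LINT x|lborel. \<phi> x *\<^sub>R u3 x t) = (LBINT x:{- L..L}. \<phi> x *\<^sub>R u3 x t)"
    unfolding set_lebesgue_integral_def
    by (intro Bochner_Integration.integral_cong) (auto split: split_indicator simp: supp)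
  also have "\<dots> = integral {- L..L} (\<lambda>x. \<phi> x *\<^sub>R u3 x t)"
    by (intro set_borel_integral_eq_integral borel_integrable_atLeastAtMost' continuous_intros cont_phi
        continuous_on_u3 assms)
  finally show ?thesis using hk by (simp add: integral_unique)
qed

lemma pairing_u3_tendsto: "((\<lambda>t. LINT x|lborel. \<phi> x *\<^sub>R u3 x t) \<longlongrightarrow> of_real (\<phi> 0)) (at_right 0)"
proof -
  have "((\<lambda>t. complex_of_real (Re (LBINT \<beta>:{0..}. osc_transform t \<beta>) / pi)) \<longlongrightarrow>
      of_real (Re (LBINT \<beta>:{0..}. osc_transform 0 \<beta>) / pi)) (at_right 0)"
    by (intro tendsto_of_real tendsto_divide tendsto_Re tendsto_const osc_transform_integral_at_right) auto
  moreover have "\<forall>\<^sub>F t in at_right 0. complex_of_real (Re (LBINT \<beta>:{0..}. osc_transform t \<beta>) / pi) =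
      (LINT x|lborel. \<phi> x *\<^sub>R u3 x t)"
    using eventually_at_right_less[of 0] by eventually_elim (simp add: pairing_u3)
  ultimately show ?thesis
    by (simp add: osc_transform_0_integral Lim_transform_eventually)
qed

end

section \<open>The Cauchy problem and the value at the origin\<close>

lemma u3_solves_cauchy_problem: "solves_cauchy_problem u3"
  unfolding solves_cauchy_problem_def
proof (intro conjI allI impI)
  note d = u3_derivatives
  have "((\<lambda>y. u3 y t) has_vector_derivative u3_deriv 1 x t) (at x) \<and>
        ((\<lambda>y. u3_deriv 1 y t) has_vector_derivative u3_deriv 2 x t) (at x) \<and>
        ((\<lambda>y. u3_deriv 2 y t) has_vector_derivative u3_deriv 3 x t) (at x) \<and>
        ((\<lambda>s. u3 x s) has_vector_derivative - u3_deriv 3 x t) (at t)" if "t > 0" for x t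
    using d(2)[OF that, of 0 x] d(2)[OF that, of 1 x] d(2)[OF that, of 2 x] d(3)[OF that, of x] d(1)[OF that]
    by (simp add: numeral_2_eq_2 numeral_3_eq_3)
  then show "\<exists>ux uxx uxxx. \<forall>x. \<forall>t>0.
        ((\<lambda>y. u3 y t) has_vector_derivative ux x t) (at x) \<and>
        ((\<lambda>y. ux y t) has_vector_derivative uxx x t) (at x) \<and>
        ((\<lambda>y. uxx y t) has_vector_derivative uxxx x t) (at x) \<and>
        ((\<lambda>s. u3 x s) has_vector_derivative - uxxx x t) (at t)"
    by blast
next
  fix \<phi> assume "test_function \<phi>"
  then show "((\<lambda>t. LINT x|lborel. \<phi> x *\<^sub>R u3 x t) \<longlongrightarrow> of_real (\<phi> 0)) (at_right 0)"
    by (rule test_function_decompose) (rule pairing_u3_tendsto)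
qed

text \<open>Continuity of \<open>u3\<close> in \<open>x\<close> gives the formulas with the factor
  \<open>1 / x\<close> their meaning at \<open>x = 0\<close>.\<close>

lemma u3_tendsto_at_0:
  assumes "t > 0" and "\<And>x. x \<noteq> 0 \<Longrightarrow> u3 x t = f x"
  shows "(f \<longlongrightarrow> u3 0 t) (at 0)"
proof -
  have "((\<lambda>x. u3 x t) \<longlongrightarrow> u3 0 t) (at 0)"
    using continuous_on_u3[OF assms(1), of UNIV] by (auto simp: continuous_on_def)
  moreover have "\<forall>\<^sub>F x in at 0. u3 x t = f x"
    using assms(2) by (simp add: eventually_at_filter)
  ultimately show ?thesis by (rule Lim_transform_eventually)
qed


theorem theorem2p2:
  fixes M :: "'a measure" and G :: "'a \<Rightarrow> real" and t :: real
  assumes "prob_space M"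
    and "t > 0"
    and "distributed M lborel G (\<lambda>y. ennreal (gen_gamma_density 3 (1 / t) y))"
  shows "solves_cauchy_problem u3 \<and>
    (\<forall>x::real.
       (\<lambda>\<beta>::real. exp (- (\<i> * of_real \<beta> * of_real x) - \<i> * of_real t * of_real \<beta> ^ 3) :: complex)
         integrable_on UNIV \<and>
       integrable M (\<lambda>\<omega>. exp (- (x / 2) * G \<omega>) * sin (sqrt 3 * x / 2 * G \<omega>)) \<and>
       set_integrable lborel {0<..}
         (\<lambda>y. exp (- (x * y / 2)) * sin (sqrt 3 / 2 * x * y) * y\<^sup>2 * exp (- t * y ^ 3)) \<and>
       u3 x t = of_real (1 / root 3 (3 * t) * airy_Ai (x / root 3 (3 * t)))) \<and>
    (\<forall>x::real. x \<noteq> 0 \<longrightarrow>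
       u3 x t = of_real (1 / (pi * x) *
         (LINT \<omega>|M. exp (- (x / 2) * G \<omega>) * sin (sqrt 3 * x / 2 * G \<omega>))) \<and>
       u3 x t = of_real (3 * t / (pi * x) *
         (LBINT y:{0<..}. exp (- (x * y / 2)) * sin (sqrt 3 / 2 * x * y) * y\<^sup>2 * exp (- t * y ^ 3)))) \<and>
    ((\<lambda>x. of_real (1 / (pi * x) *
         (LINT \<omega>|M. exp (- (x / 2) * G \<omega>) * sin (sqrt 3 * x / 2 * G \<omega>)))) \<longlongrightarrow> u3 0 t) (at 0) \<and>
    ((\<lambda>x. of_real (3 * t / (pi * x) *
         (LBINT y:{0<..}. exp (- (x * y / 2)) * sin (sqrt 3 / 2 * x * y) * y\<^sup>2 * exp (- t * y ^ 3)))) \<longlongrightarrow> u3 0 t) (at 0)"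
proof -
  note t = assms(2)
  have E: "(LINT \<omega>|M. exp (- (x / 2) * G \<omega>) * sin (sqrt 3 * x / 2 * G \<omega>)) =
      3 * t * (LBINT y:{0<..}. exp (- (x * y / 2)) * sin (sqrt 3 / 2 * x * y) * y\<^sup>2 * exp (- t * y ^ 3))" for x
    by (rule expectation_gen_gamma[OF t assms(3)])
  have rot: "u3 x t = of_real (3 * t / (pi * x) *
      (LBINT y:{0<..}. exp (- (x * y / 2)) * sin (sqrt 3 / 2 * x * y) * y\<^sup>2 * exp (- t * y ^ 3)))"
    if "x \<noteq> 0" for x
    by (rule u3_eq_rotated[OF t that])
  \<comment> \<open>The constant \<open>3 * t\<close> is already contained in the gamma density, so
    this formula is the rotated one with that constant absorbed.\<close>
  have exp: "u3 x t = of_real (1 / (pi * x) *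
      (LINT \<omega>|M. exp (- (x / 2) * G \<omega>) * sin (sqrt 3 * x / 2 * G \<omega>)))" if "x \<noteq> 0" for x
    unfolding E rot[OF that] by simp
  show ?thesis
    using u3_solves_cauchy_problem rot exp u3_tendsto_at_0[OF t rot] u3_tendsto_at_0[OF t exp]
      has_integral_integrable[OF fundamental_solution_has_integral[OF t]]
      integrable_gen_gamma[OF t assms(3)] set_integrable_rotated[OF t] u3_eq_airy_Ai[OF t]
    by (intro conjI allI impI) assumption+
qed

end
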